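(* Let $p$ be a prime, and let $K \subset S^3$ be a knot which admits a symmetric union presentation with partial knot $J$. Then $$\mathrm{col}_p(J) \;\leq\; \mathrm{col}_p(K) \;\leq\; \frac{(\mathrm{col}_p(J))^2}{p},$$ where $\mathrm{col}_p(\cdot)$ denotes the number of $p$-colorings (trivial and non-trivial) of a knot.
   Context: Symmetric unions. Let $D$ be a knot diagram in the plane, let $\ell$ be a vertical axis (line) in the plane disjoint from $D$, and let $-D$ be the reflection of $D$ over $\ell$; it is a diagram of the mirror image $-J$ of the knot $J$ represented by $D$. Let $\Delta_0,\dots,\Delta_k$ ($k \geq 0$) be pairwise disjoint disks in the projection plane, each symmetric under reflection over $\ell$ and each meeting each of $D$ and $-D$ in a single crossingless arc (so that $\Delta_i$ contains two "vertical" arcs, one on each side of $\ell$). For integers $n_1,\dots,n_k$, let $D \sqcup -D(n_1,\dots,n_k)$ denote the diagram obtained from $D \sqcup -D$ by replacing the tangle in $\Delta_0$ with the $\infty$-tangle (two crossingless "horizontal" arcs, one joining the two upper endpoints and one joining the two lower endpoints, each crossing $\ell$), and, for $1 \le i \le k$, replacing the tangle in $\Delta_i$ with the tangle diagram consisting of $n_i$ (signed) crossings on the axis $\ell$, i.e. the two vertical arcs twisted about each other by $|n_i|$ half-twists with crossings stacked along $\ell$, with handedness given by the sign of $n_i$ under a fixed convention. A symmetric union presentation for a knot $K$ is a realization of $K$ by a diagram of the form $D \sqcup -D(n_1,\dots,n_k)$; the knot type $J$ of $D$ is then called the partial knot of this presentation. Colorings. A $p$-coloring of a diagram $D$ is an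 assignment of an element of $\mathbb{Z}_p = \mathbb{Z}/p\mathbb{Z}$ to each strand (arc from undercrossing to undercrossing) of $D$ such that at each crossing, if the overstrand is labeled $a_i$ and the two understrands are labeled $a_j$ and $a_k$, then $a_j + a_k - 2a_i \equiv 0 \pmod p$. The number of $p$-colorings of $D$ (including the $p$ trivial, i.e. constant, ones) is invariant under Reidemeister moves, and $\mathrm{col}_p(K)$ denotes this number for any diagram of the knot $K$. *)

theory Defs
  imports Complex_Main "HOL-Library.FuncSet" "HOL-Number_Theory.Cong"
    "HOL-Computational_Algebra.Primes"
begin

section \<open>Link diagrams in the plane\<close>

text \<open>
  A diagram in general position with respect to the height function is cut by horizontal lines
  into slices, read from bottom to top, each containing a single local minimum, local maximum or
  crossing.  The strands meeting a horizontal line are numbered \<open>0, 1, 2, \<dots>\<close> from left to right.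

  \<open>Birth i\<close>: a local minimum, whose two new strands occupy positions \<open>i\<close> and \<open>i + 1\<close> above it.
  \<open>Death i\<close>: a local maximum joining the strands \<open>i\<close> and \<open>i + 1\<close> below it.
  \<open>Cross c i\<close>: the strands \<open>i\<close> and \<open>i + 1\<close> cross; the one running from bottom left to top right is
  the overstrand iff \<open>c\<close> holds.
\<close>

datatype slice = Birth nat | Death nat | Cross bool nat

fun pos :: "slice \<Rightarrow> nat" where
  "pos (Birth i) = i"
| "pos (Death i) = i"
| "pos (Cross c i) = i"

fun move_to :: "nat \<Rightarrow> slice \<Rightarrow> slice" where
  "move_to k (Birth i) = Birth k"
| "move_to k (Death i) = Death k"
| "move_to k (Cross c i) = Cross c k"

fun ins :: "slice \<Rightarrow> nat" where
  "ins (Birth i) = 0"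
| "ins (Death i) = 2"
| "ins (Cross c i) = 2"

fun outs :: "slice \<Rightarrow> nat" where
  "outs (Birth i) = 2"
| "outs (Death i) = 0"
| "outs (Cross c i) = 2"

definition width_above :: "nat \<Rightarrow> slice \<Rightarrow> nat" where
  "width_above n s = n - ins s + outs s"

text \<open>Number of strands meeting the horizontal line just below the slice with index \<open>j\<close>.\<close>

definition width :: "slice list \<Rightarrow> nat \<Rightarrow> nat" where
  "width D j = foldl width_above 0 (take j D)"

definition diagram :: "slice list \<Rightarrow> bool" where
  "diagram D \<longleftrightarrow>
     (\<forall>j<length D. pos (D ! j) + ins (D ! j) \<le> width D j) \<and> width D (length D) = 0"

text \<open>The point \<open>(j, i)\<close> is the \<open>i\<close>-th intersection of the diagram with the line below slice \<open>j\<close>.\<close>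

type_synonym point = "nat \<times> nat"

definition points :: "slice list \<Rightarrow> point set" where
  "points D = {(j, i). j \<le> length D \<and> i < width D j}"

text \<open>Two points joined by a piece of the diagram, within one slice, that is not an understrand.\<close>

inductive over_joined :: "slice list \<Rightarrow> point \<Rightarrow> point \<Rightarrow> bool" for D where
  left: "j < length D \<Longrightarrow> i < pos (D ! j) \<Longrightarrow> over_joined D (j, i) (Suc j, i)"
| right: "j < length D \<Longrightarrow> pos (D ! j) + ins (D ! j) \<le> i \<Longrightarrow> i < width D j \<Longrightarrow>
    over_joined D (j, i) (Suc j, i - ins (D ! j) + outs (D ! j))"
| birth: "j < length D \<Longrightarrow> D ! j = Birth i \<Longrightarrow> over_joined D (Suc j, i) (Suc j, Suc i)"
| death: "j < length D \<Longrightarrow> D ! j = Death i \<Longrightarrow> over_joined D (j, i) (j, Suc i)"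
| cross_rising: "j < length D \<Longrightarrow> D ! j = Cross True i \<Longrightarrow> over_joined D (j, i) (Suc j, Suc i)"
| cross_falling: "j < length D \<Longrightarrow> D ! j = Cross False i \<Longrightarrow> over_joined D (j, Suc i) (Suc j, i)"

text \<open>The two ends of the understrand at a crossing.\<close>

inductive under_joined :: "slice list \<Rightarrow> point \<Rightarrow> point \<Rightarrow> bool" for D where
  cross_rising: "j < length D \<Longrightarrow> D ! j = Cross True i \<Longrightarrow> under_joined D (j, Suc i) (Suc j, i)"
| cross_falling: "j < length D \<Longrightarrow> D ! j = Cross False i \<Longrightarrow> under_joined D (j, i) (Suc j, Suc i)"

definition strand :: "slice list \<Rightarrow> point \<Rightarrow> point set" where
  "strand D x = {y. equivclp (over_joined D) x y}"

definition strands :: "slice list \<Rightarrow> point set set" where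
  "strands D = strand D ` points D"

definition component :: "slice list \<Rightarrow> point \<Rightarrow> point set" where
  "component D x = {y. equivclp (sup (over_joined D) (under_joined D)) x y}"

definition knot_diagram :: "slice list \<Rightarrow> bool" where
  "knot_diagram D \<longleftrightarrow> diagram D \<and> card (component D ` points D) = 1"


section \<open>Knots\<close>

text \<open>
  Planar isotopy (exchange of the heights of distant slices, cancellation of a minimum against a
  maximum, sliding a strand across a minimum or maximum) and the three Reidemeister moves.  Given
  the isotopy moves, the remaining variants of the Reidemeister moves follow from those listed.
\<close>

inductive local_move :: "slice list \<Rightarrow> slice list \<Rightarrow> bool" where
  exchange: "pos s + outs s \<le> pos t \<Longrightarrow>
    local_move [s, t] [move_to (pos t - outs s + ins s) t, s]"
| zigzag_right: "local_move [Birth (Suc i), Death i] []"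
| zigzag_left: "local_move [Birth i, Death (Suc i)] []"
| slide_birth: "local_move [Birth (Suc i), Cross c i] [Birth i, Cross (\<not> c) (Suc i)]"
| slide_death: "local_move [Cross c i, Death (Suc i)] [Cross (\<not> c) (Suc i), Death i]"
| R1_birth: "local_move [Birth i, Cross c i] [Birth i]"
| R1_death: "local_move [Cross c i, Death i] [Death i]"
| R2: "local_move [Cross c i, Cross (\<not> c) i] []"
| R3: "local_move [Cross c i, Cross c (Suc i), Cross c i]
                  [Cross c (Suc i), Cross c i, Cross c (Suc i)]"

inductive move :: "slice list \<Rightarrow> slice list \<Rightarrow> bool" where
  "local_move l r \<Longrightarrow> diagram (u @ l @ v) \<Longrightarrow> diagram (u @ r @ v) \<Longrightarrow>
   move (u @ l @ v) (u @ r @ v)"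

text \<open>A knot (isotopy class of knots in the 3-sphere) is the set of all its diagrams.\<close>

definition knot_type :: "slice list \<Rightarrow> slice list set" where
  "knot_type D = {E. equivclp move D E}"

definition knots :: "slice list set set" where
  "knots = knot_type ` {D. knot_diagram D}"


section \<open>Colorings\<close>

text \<open>The integers \<open>0, \<dots>, p - 1\<close> represent the elements of \<open>\<int>/p\<int>\<close>.\<close>

definition colorings :: "nat \<Rightarrow> slice list \<Rightarrow> (point set \<Rightarrow> int) set" where
  "colorings p D =
     {a \<in> strands D \<rightarrow>\<^sub>E {0..<int p}.
        \<forall>j<length D. \<forall>i.
          (D ! j = Cross True i \<longrightarrow>
             [a (strand D (j, Suc i)) + a (strand D (Suc j, i))
                - 2 * a (strand D (j, i)) = 0] (mod int p)) \<and>
          (D ! j = Cross False i \<longrightarrow>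
             [a (strand D (j, i)) + a (strand D (Suc j, Suc i))
                - 2 * a (strand D (j, Suc i)) = 0] (mod int p))}"

text \<open>The common number of colorings of all diagrams of \<open>K\<close>.\<close>

definition col :: "nat \<Rightarrow> slice list set \<Rightarrow> nat" where
  "col p K = (THE n. \<forall>D\<in>K. card (colorings p D) = n)"


section \<open>Symmetric unions\<close>

text \<open>
  The diagram \<open>D\<close> lies to the left of the axis.  A disk that is symmetric about the axis and meets
  \<open>D\<close> in one crossingless arc can be shrunk towards the axis, pulling the arc along; afterwards the
  disk sits at a height between two slices of \<open>D\<close> and contains exactly the rightmost strand of \<open>D\<close>
  at that height, together with its mirror image.  So \<open>D\<close> with its disks is a list of slices
  interspersed with disks, listed from bottom to top; \<open>Disk_Inf\<close> is the disk that receives the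
  \<open>\<infinity>\<close>-tangle and \<open>Disk_Twist n\<close> one that receives \<open>n\<close> crossings on the axis.
\<close>

datatype item = Slice slice | Disk_Inf | Disk_Twist int

fun underlying :: "item list \<Rightarrow> slice list" where
  "underlying [] = []"
| "underlying (Slice s # T) = s # underlying T"
| "underlying (Disk_Inf # T) = underlying T"
| "underlying (Disk_Twist n # T) = underlying T"

definition diagram_with_disks :: "item list \<Rightarrow> bool" where
  "diagram_with_disks T \<longleftrightarrow>
     knot_diagram (underlying T) \<and>
     count_list T Disk_Inf = 1 \<and>
     (\<forall>j<length T. T ! j \<in> insert Disk_Inf (range Disk_Twist) \<longrightarrow>
        foldl width_above 0 (underlying (take j T)) > 0)"

text \<open>Reflection in a vertical line of a slice whose lower line has \<open>n\<close> strands.  Over- and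
  understrands stay what they are, so a rising overstrand becomes a falling one.\<close>

fun reflect :: "nat \<Rightarrow> slice \<Rightarrow> slice" where
  "reflect n (Birth i) = Birth (n - i)"
| "reflect n (Death i) = Death (n - 2 - i)"
| "reflect n (Cross c i) = Cross (\<not> c) (n - 2 - i)"

text \<open>\<open>symmetric_union n T\<close> has \<open>n\<close> strands on either side of the axis at the bottom, so the two
  strands next to the axis have positions \<open>n - 1\<close> and \<open>n\<close>.  A slice of \<open>D\<close> is placed on the left
  just below its reflection on the right.\<close>

fun symmetric_union :: "nat \<Rightarrow> item list \<Rightarrow> slice list" where
  "symmetric_union n [] = []"
| "symmetric_union n (Slice s # T) =
     (let m = width_above n s; s' = reflect n s
      in [s, move_to (m + pos s') s'] @ symmetric_union m T)"
| "symmetric_union n (Disk_Inf # T) = [Death (n - 1), Birth (n - 1)] @ symmetric_union n T"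
| "symmetric_union n (Disk_Twist k # T) =
     replicate (nat \<bar>k\<bar>) (Cross (k > 0) (n - 1)) @ symmetric_union n T"

definition has_symmetric_union_presentation :: "slice list set \<Rightarrow> slice list set \<Rightarrow> bool" where
  "has_symmetric_union_presentation K J \<longleftrightarrow>
     (\<exists>T. diagram_with_disks T \<and> underlying T \<in> J \<and> symmetric_union 0 T \<in> K)"

end

theory Submission
  imports Defs
begin

text \<open>
  A coloring of the symmetric union restricts to colors on the left half, and, read in the mirror,
  to colors \<open>w\<close> on the right half; write the former as \<open>w + e\<close>.  Crossings off the axis act linearly
  and in the same way on both halves, a twist region on the axis changes \<open>w\<close> by a multiple of \<open>e\<close>
  but preserves \<open>e\<close>, and the \<open>\<infinity>\<close>-tangle forces \<open>e = 0\<close> at its two arcs.  So \<open>e\<close> is a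
  coloring of \<open>D\<close> that vanishes at one point; by translation there are \<open>col p J / p\<close> of these.  Two
  colorings with the same \<open>e\<close> differ by a coloring of \<open>D\<close> cut open at that point.  The alternating sum
  of the colors along a horizontal line is the same for all lines, hence the two ends of the
  cut have the same color and there are just \<open>col p J\<close> colorings of the cut diagram.  This is the
  upper bound.  The lower bound comes from the colorings with \<open>e = 0\<close>.

  Since \<open>col\<close> is a property of the knot type, the invariance under the moves has to be
  established as well.  It is visible locally once colorings are counted level by level,
  from the bottom of the diagram to its top.
\<close>

section \<open>Counting colorings level by level\<close>

text \<open>
  The colors along a horizontal line are given by a function on all positions, of which only
  those below the width matter; so no widths have to be tracked.  The argument \<open>c\<close> is the color
  of the strand created by a local minimum and irrelevant for the other slices, for which
  \<open>new_colors\<close> offers a dummy.  Colors are plain integers, only compared modulo \<open>p\<close>.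
\<close>

fun extend :: "slice \<Rightarrow> int \<Rightarrow> (nat \<Rightarrow> int) \<Rightarrow> nat \<Rightarrow> int" where
  "extend (Birth i) c v = (\<lambda>k. if k < i then v k else if k < i + 2 then c else v (k - 2))"
| "extend (Death i) c v = (\<lambda>k. if k < i then v k else v (k + 2))"
| "extend (Cross b i) c v = (\<lambda>k.
     if k = i then (if b then 2 * v i - v (Suc i) else v (Suc i))
     else if k = Suc i then (if b then v i else 2 * v (Suc i) - v i)
     else v k)"

text \<open>Only a local maximum can obstruct a coloring: at a crossing the relation can always be
  solved for the outgoing understrand.\<close>

fun passable :: "nat \<Rightarrow> slice \<Rightarrow> (nat \<Rightarrow> int) \<Rightarrow> bool" where
  "passable p (Death i) v \<longleftrightarrow> [v i = v (Suc i)] (mod int p)"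
| "passable p (Birth i) v \<longleftrightarrow> True"
| "passable p (Cross b i) v \<longleftrightarrow> True"

fun new_colors :: "nat \<Rightarrow> slice \<Rightarrow> int set" where
  "new_colors p (Birth i) = {0..<int p}"
| "new_colors p (Death i) = {0}"
| "new_colors p (Cross b i) = {0}"

text \<open>Counts the colorings of everything above a line with colors \<open>v\<close>: a free
  choice at each minimum, a test at each maximum. Because it consumes the slices one by one, a local
  move can be examined in isolation.\<close>

fun completions :: "nat \<Rightarrow> slice list \<Rightarrow> (nat \<Rightarrow> int) \<Rightarrow> nat" where
  "completions p [] v = 1"
| "completions p (s # D) v =
     (if passable p s v then \<Sum>c\<in>new_colors p s. completions p D (extend s c v) else 0)"

lemma finite_new_colors [simp]: "finite (new_colors p s)"
  by (cases s) auto

lemma cong_extend: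
  assumes "\<And>k. [u k = v k] (mod int p)" "[c = d] (mod int p)"
  shows "[extend s c u k = extend s d v k] (mod int p)"
  using assms by (cases s) (auto intro!: cong_diff cong_mult)

lemma cong_passable:
  assumes "\<And>k. [u k = v k] (mod int p)"
  shows "passable p s u \<longleftrightarrow> passable p s v"
  using assms by (cases s) (auto intro: cong_trans cong_sym)

lemma cong_completions:
  assumes "\<And>k. [u k = v k] (mod int p)"
  shows "completions p D u = completions p D v"
  using assms
proof (induction D arbitrary: u v)
  case (Cons s D)
  have "completions p D (extend s c u) = completions p D (extend s c v)" for c
    by (rule Cons.IH) (intro cong_extend Cons.prems cong_refl)
  then show ?case
    using cong_passable[OF Cons.prems] by simp
qed simp

section \<open>Sums over the residues modulo \<open>p\<close>\<close>

lemma cong_diff_swap: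
  fixes a b c m :: int
  shows "[a - b = c] (mod m) \<longleftrightarrow> [b = a - c] (mod m)"
proof -
  have "a - b - c = - (b - (a - c))" by simp
  then show ?thesis
    unfolding cong_iff_dvd_diff by (metis dvd_minus_iff)
qed

text \<open>Used where a maximum or a disk forces a color that is summed over: exactly one
  representative meets the congruence.\<close>

lemma sum_single_residue:
  fixes f :: "int \<Rightarrow> nat"
  assumes "p > 0"
  shows "(\<Sum>c\<in>{0..<int p}. if [x = c] (mod int p) then f c else 0) = f (x mod int p)"
proof -
  have "(if [x = c] (mod int p) then f c else 0) = (if c = x mod int p then f c else 0)"
    if "c \<in> {0..<int p}" for c
    using that by (auto simp: cong_def)
  then have "(\<Sum>c\<in>{0..<int p}. if [x = c] (mod int p) then f c else 0)
      = (\<Sum>c\<in>{0..<int p}. if c = x mod int p then f c else 0)"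
    by (intro sum.cong) auto
  also have "\<dots> = f (x mod int p)"
    using assms by (simp add: sum.delta)
  finally show ?thesis .
qed

lemma bij_betw_mod:
  assumes "p > 0" and inv: "\<And>x. [g (h x) = x] (mod int p)" "\<And>x. [h (g x) = x] (mod int p)"
    and "\<And>x y. [x = y] (mod int p) \<Longrightarrow> [g x = g y] (mod int p)"
    and "\<And>x y. [x = y] (mod int p) \<Longrightarrow> [h x = h y] (mod int p)"
  shows "bij_betw (\<lambda>x. g x mod int p) {0..<int p} {0..<int p}"
proof (rule bij_betw_byWitness[where f' = "\<lambda>x. h x mod int p"])
  show "\<forall>a\<in>{0..<int p}. h (g a mod int p) mod int p = a"
    using assms(5)[of "g a mod int p" "g a" for a] inv(2) by (auto simp: cong_def)
  show "\<forall>a\<in>{0..<int p}. g (h a mod int p) mod int p = a"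
    using assms(4)[of "h a mod int p" "h a" for a] inv(1) by (auto simp: cong_def)
qed (use assms(1) in auto)

lemma sum_reflect_mod:
  fixes f :: "int \<Rightarrow> nat"
  assumes "p > 0"
  shows "(\<Sum>c\<in>{0..<int p}. f ((x - c) mod int p)) = (\<Sum>c\<in>{0..<int p}. f c)"
  by (rule sum.reindex_bij_betw[OF bij_betw_mod[where h = "\<lambda>c. x - c"]])
    (use assms in \<open>auto intro: cong_diff\<close>)

lemma sum_shift_mod:
  fixes f :: "int \<Rightarrow> nat"
  assumes "p > 0"
  shows "(\<Sum>c\<in>{0..<int p}. f ((c + x) mod int p)) = (\<Sum>c\<in>{0..<int p}. f c)"
  by (rule sum.reindex_bij_betw[OF bij_betw_mod[where h = "\<lambda>c. c - x"]])
    (use assms in \<open>auto intro: cong_diff cong_add\<close>)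

section \<open>Invariance under the moves\<close>

text \<open>The slices touch disjoint positions, so their effects commute once \<open>t\<close> is
  renumbered; for two minima the sums over the new colors are interchanged.\<close>

lemma completions_exchange:
  assumes "pos s + outs s \<le> pos t"
  defines "t' \<equiv> move_to (pos t - outs s + ins s) t"
  shows "completions p (s # t # D) v = completions p (t' # s # D) v"
proof -
  \<comment> \<open>The offset \<open>d\<close> removes truncated subtraction from the positions of
    both slices.\<close>
  obtain d where d: "pos t = pos s + outs s + d"
    using assms(1) le_Suc_ex by blast
  then have t': "t' = move_to (pos s + ins s + d) t"
    by (simp add: t'_def ac_simps)
  have [simp]: "new_colors p t' = new_colors p t"
    unfolding t' by (cases t) auto
  have ok: "passable p t (extend s c v) \<longleftrightarrow> passable p t' v" for c
    using d unfolding t' by (cases s; cases t) simp_all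
  have ok': "passable p s (extend t' c v) \<longleftrightarrow> passable p s v" for c
    using d unfolding t' by (cases s; cases t) simp_all
  have [simp]: "Suc (Suc (k - 2)) = k" if "\<not> k < Suc (Suc m)" for k m :: nat
    using that by simp
  have "extend t c' (extend s c v) k = extend s c (extend t' c' v) k" for c c' k
    using d unfolding t' by (cases s; cases t) (simp_all, auto)
  then have "extend t c' (extend s c v) = extend s c (extend t' c' v)" for c c'
    by blast
  then show ?thesis
    using ok ok' by (auto intro: sum.swap)
qed

lemma completions_local_move:
  assumes "local_move l r" "p > 0"
  shows "completions p (l @ D) v = completions p (r @ D) v"
  using assms(1)
proof cases
  case exchange then show ?thesis using completions_exchange by simp
next
  case (zigzag_right i)
  \<comment> \<open>The maximum joins the old strand to one end of the minimum, so the new color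
    \<open>c\<close> must agree with \<open>v i\<close> and then takes its place.\<close>
  have "extend (Death i) 0 (extend (Birth (Suc i)) c v) k = (v(i := c)) k" for c k
    by auto
  then have "extend (Death i) 0 (extend (Birth (Suc i)) c v) = v(i := c)" for c
    by blast
  moreover have "passable p (Death i) (extend (Birth (Suc i)) c v) \<longleftrightarrow> [v i = c] (mod int p)" for c
    by simp
  ultimately have "completions p (l @ D) v
     = (\<Sum>c\<in>{0..<int p}. if [v i = c] (mod int p) then completions p D (v(i := c)) else 0)"
    unfolding zigzag_right by (simp del: extend.simps passable.simps(1) cong: if_cong)
  also have "\<dots> = completions p D (v(i := v i mod int p))"
    by (rule sum_single_residue) fact
  also have "\<dots> = completions p D v"
    by (rule cong_completions) auto
  finally show ?thesis using zigzag_right by simp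
next
  case (zigzag_left i)
  have "extend (Death (Suc i)) 0 (extend (Birth i) c v) k = (v(i := c)) k" for c k
    by auto
  then have "extend (Death (Suc i)) 0 (extend (Birth i) c v) = v(i := c)" for c
    by blast
  moreover have "passable p (Death (Suc i)) (extend (Birth i) c v) \<longleftrightarrow> [c = v i] (mod int p)" for c
    by simp
  ultimately have "completions p (l @ D) v
     = (\<Sum>c\<in>{0..<int p}. if [c = v i] (mod int p) then completions p D (v(i := c)) else 0)"
    unfolding zigzag_left by (simp del: extend.simps passable.simps(1) cong: if_cong)
  also have "\<dots> = (\<Sum>c\<in>{0..<int p}. if [v i = c] (mod int p) then completions p D (v(i := c)) else 0)"
    by (simp add: cong_sym_eq)
  also have "\<dots> = completions p D (v(i := v i mod int p))"
    by (rule sum_single_residue) fact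
  also have "\<dots> = completions p D v"
    by (rule cong_completions) auto
  finally show ?thesis using zigzag_left by simp
next
  case (slide_birth i c)
  show ?thesis
  proof (cases c)
    case True
    have "completions p (r @ D) v = (\<Sum>x\<in>{0..<int p}.
        completions p D (extend (Cross False (Suc i)) 0 (extend (Birth i) x v)))"
      using slide_birth True by simp
    \<comment> \<open>The arc of the minimum passes under the old strand, with colors
      \<open>x\<close> and \<open>2 * v i - x\<close> on its two sides. The two diagrams introduce
      different ones of these, so the sum is reindexed.\<close>
    also have "\<dots> = (\<Sum>x\<in>{0..<int p}.
        completions p D (extend (Cross False (Suc i)) 0 (extend (Birth i) ((2 * v i - x) mod int p) v)))"
      by (rule sum_reflect_mod[symmetric]) fact
    also have "\<dots> = (\<Sum>x\<in>{0..<int p}.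
        completions p D (extend (Cross True i) 0 (extend (Birth (Suc i)) x v)))"
    proof (intro sum.cong refl cong_completions)
      fix x k
      have "[extend (Cross False (Suc i)) 0 (extend (Birth i) ((2 * v i - x) mod int p) v) k =
             extend (Cross False (Suc i)) 0 (extend (Birth i) (2 * v i - x) v) k] (mod int p)"
        by (intro cong_extend) auto
      also have "extend (Cross False (Suc i)) 0 (extend (Birth i) (2 * v i - x) v) k =
            extend (Cross True i) 0 (extend (Birth (Suc i)) x v) k"
        by (auto simp: less_Suc_eq)
      finally show "[extend (Cross False (Suc i)) 0 (extend (Birth i) ((2 * v i - x) mod int p) v) k =
            extend (Cross True i) 0 (extend (Birth (Suc i)) x v) k] (mod int p)" .
    qed
    also have "\<dots> = completions p (l @ D) v"
      using slide_birth True by simp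
    finally show ?thesis ..
  next
    case False
    have "extend (Cross True (Suc i)) 0 (extend (Birth i) x v) =
         extend (Cross False i) 0 (extend (Birth (Suc i)) x v)" for x
      by (auto simp: less_Suc_eq)
    then show ?thesis using slide_birth False by simp
  qed
next
  case (slide_death c i)
  \<comment> \<open>For \<open>c\<close> true the remaining strand passes under the arc and gets
    \<open>2 * a - b\<close>, with \<open>a\<close> read at one or the other foot of the maximum;
    the two readings agree because the maximum is passable.\<close>
  have "completions p D (extend (Death (Suc i)) 0 (extend (Cross c i) 0 v))
      = completions p D (extend (Death i) 0 (extend (Cross (\<not> c) (Suc i)) 0 v))"
    if "passable p (Death (Suc i)) (extend (Cross c i) 0 v)"
    using that by (intro cong_completions) (cases c; auto intro!: cong_diff cong_mult)
  moreover have "passable p (Death (Suc i)) (extend (Cross c i) 0 v) \<longleftrightarrow>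
      passable p (Death i) (extend (Cross (\<not> c) (Suc i)) 0 v)"
    using cong_diff_swap[of "2 * v (Suc i)" "v i"] by (cases c) auto
  ultimately show ?thesis
    unfolding slide_death by (simp del: extend.simps passable.simps(1))
next
  case (R1_birth i c)
  have "extend (Cross c i) 0 (extend (Birth i) x v) = extend (Birth i) x v" for x
    by (cases c) auto
  then show ?thesis using R1_birth by simp
next
  case (R1_death c i)
  have "extend (Death i) 0 (extend (Cross c i) 0 v) = extend (Death i) 0 v"
    by (cases c) auto
  moreover have "passable p (Death i) (extend (Cross c i) 0 v) \<longleftrightarrow> passable p (Death i) v"
    using cong_diff_swap[of "2 * v i" "v (Suc i)" "v i"]
      cong_diff_swap[of "2 * v (Suc i)" "v i" "v (Suc i)"]
    by (cases c) (auto simp: cong_sym_eq)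
  ultimately show ?thesis
    unfolding R1_death by (simp del: extend.simps passable.simps(1))
next
  case (R2 c i)
  have "extend (Cross (\<not> c) i) 0 (extend (Cross c i) 0 v) = v"
    by (cases c) auto
  then show ?thesis using R2 by simp
next
  case (R3 c i)
  \<comment> \<open>Crossings act by integral linear maps, and these satisfy the braid relation
    exactly, not just modulo \<open>p\<close>.\<close>
  have "extend (Cross c i) 0 (extend (Cross c (Suc i)) 0 (extend (Cross c i) 0 v)) =
        extend (Cross c (Suc i)) 0 (extend (Cross c i) 0 (extend (Cross c (Suc i)) 0 v))"
    by (cases c) auto
  then show ?thesis using R3 by simp
qed

text \<open>The slices \<open>u\<close> merely feed other colors into what follows, which is why the
  assumption ranges over all \<open>v\<close>.\<close>

lemma completions_append_cong:
  assumes "\<And>v. completions p D v = completions p E v"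
  shows "completions p (u @ D) v = completions p (u @ E) v"
proof (induction u arbitrary: v)
  case Nil
  show ?case using assms by simp
qed simp

lemma completions_move:
  assumes "move D E" "p > 0"
  shows "completions p D v = completions p E v"
  using assms(1)
proof cases
  case (1 l r u w)
  show ?thesis
    unfolding 1 by (intro completions_append_cong completions_local_move 1 assms(2))
qed

section \<open>Colorings of the points of a diagram\<close>

text \<open>The recursive form of \<open>diagram\<close> with any number of strands at the bottom,
  so that inductions can strip slices from below.\<close>

fun well_formed :: "nat \<Rightarrow> slice list \<Rightarrow> bool" where
  "well_formed n [] \<longleftrightarrow> n = 0"
| "well_formed n (s # D) \<longleftrightarrow> pos s + ins s \<le> n \<and> well_formed (width_above n s) D"

lemma well_formed_iff:
  "well_formed n D \<longleftrightarrow>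
     (\<forall>j<length D. pos (D ! j) + ins (D ! j) \<le> foldl width_above n (take j D)) \<and>
     foldl width_above n D = 0"
  by (induction D arbitrary: n) (auto simp: All_less_Suc2)

lemma diagram_iff_well_formed: "diagram D \<longleftrightarrow> well_formed 0 D"
  by (simp add: diagram_def width_def well_formed_iff)

definition linked :: "nat \<Rightarrow> nat \<Rightarrow> slice \<Rightarrow> (nat \<Rightarrow> int) \<Rightarrow> (nat \<Rightarrow> int) \<Rightarrow> bool" where
  "linked p n s x y \<longleftrightarrow> passable p s x \<and>
     (\<exists>c\<in>new_colors p s. \<forall>k<width_above n s. [y k = extend s c x k] (mod int p))"

definition level_points :: "nat \<Rightarrow> slice list \<Rightarrow> point set" where
  "level_points n D = {(j, i). j \<le> length D \<and> i < foldl width_above n (take j D)}"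

text \<open>A notion between \<open>completions\<close> and \<open>colorings\<close>: colors sit on
  the points of the horizontal lines rather than on strands, and the lowest line is prescribed
  modulo \<open>p\<close>.\<close>

definition level_colorings :: "nat \<Rightarrow> nat \<Rightarrow> slice list \<Rightarrow> (nat \<Rightarrow> int) \<Rightarrow> (point \<Rightarrow> int) set" where
  "level_colorings p n D v =
     {f \<in> level_points n D \<rightarrow>\<^sub>E {0..<int p}.
        (\<forall>i<n. [f (0, i) = v i] (mod int p)) \<and>
        (\<forall>j<length D. linked p (foldl width_above n (take j D)) (D ! j)
           (\<lambda>i. f (j, i)) (\<lambda>i. f (Suc j, i)))}"

lemma cong_passable_below:
  assumes "pos s + ins s \<le> n" "\<And>k. k < n \<Longrightarrow> [u k = v k] (mod int p)"
  shows "passable p s u \<longleftrightarrow> passable p s v"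
proof (cases s)
  case (Death i)
  then have "[u i = v i] (mod int p)" "[u (Suc i) = v (Suc i)] (mod int p)"
    using assms by auto
  then show ?thesis
    unfolding Death by (auto intro: cong_trans cong_sym)
qed auto

lemma cong_extend_below:
  assumes "pos s + ins s \<le> n" "\<And>k. k < n \<Longrightarrow> [u k = v k] (mod int p)"
    and "[c = d] (mod int p)" and "k < width_above n s"
  shows "[extend s c u k = extend s d v k] (mod int p)"
  using assms by (cases s) (auto simp: width_above_def intro!: cong_diff cong_mult)

lemma linked_cong_below:
  assumes "pos s + ins s \<le> n" "\<And>k. k < n \<Longrightarrow> [u k = v k] (mod int p)"
  shows "linked p n s u y \<longleftrightarrow> linked p n s v y"
proof -
  have "(\<forall>k<width_above n s. [y k = extend s c u k] (mod int p)) \<longleftrightarrow>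
      (\<forall>k<width_above n s. [y k = extend s c v k] (mod int p))" for c
    using cong_extend_below[OF assms cong_refl] by (meson cong_sym cong_trans)
  then show ?thesis
    using cong_passable_below[OF assms] by (simp add: linked_def)
qed

lemma level_points_Cons:
  "(j, i) \<in> level_points n (s # D) \<longleftrightarrow>
     (case j of 0 \<Rightarrow> i < n | Suc j \<Rightarrow> (j, i) \<in> level_points (width_above n s) D)"
  by (auto simp: level_points_def split: nat.splits)

lemma finite_level_points: "finite (level_points n D)"
proof -
  have "level_points n D = (SIGMA j:{..length D}. {..<foldl width_above n (take j D)})"
    by (auto simp: level_points_def)
  then show ?thesis by simp
qed

lemma finite_level_colorings: "finite (level_colorings p n D v)"
proof (rule finite_subset)
  show "level_colorings p n D v \<subseteq> level_points n D \<rightarrow>\<^sub>E {0..<int p}"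
    by (auto simp: level_colorings_def)
qed (auto intro: finite_PiE finite_level_points)

text \<open>Undoes the removal of the lowest line, \<open>g\<close> being indexed from the line
  above it.\<close>

definition prepend_level :: "nat \<Rightarrow> slice list \<Rightarrow> (nat \<Rightarrow> int) \<Rightarrow> (point \<Rightarrow> int) \<Rightarrow> point \<Rightarrow> int" where
  "prepend_level n D v g =
     restrict (\<lambda>(j, i). case j of 0 \<Rightarrow> v i | Suc j \<Rightarrow> g (j, i)) (level_points n D)"

lemma prepend_level_0: "i < n \<Longrightarrow> prepend_level n D v g (0, i) = v i"
  by (simp add: prepend_level_def level_points_def)

lemma prepend_level_Suc:
  assumes "g \<in> extensional (level_points (width_above n s) D)"
  shows "prepend_level n (s # D) v g (Suc j, i) = g (j, i)"
  using assms by (auto simp: prepend_level_def level_points_Cons extensional_def)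

lemma prepend_level_in_level_colorings:
  assumes wf: "well_formed n (s # D)" and ok: "passable p s v" and c: "c \<in> new_colors p s"
    and g: "g \<in> level_colorings p (width_above n s) D (extend s c v)" and p: "p > 0"
  shows "prepend_level n (s # D) (\<lambda>i. v i mod int p) g \<in> level_colorings p n (s # D) v"
    (is "?f \<in> _")
proof -
  have ext: "g \<in> extensional (level_points (width_above n s) D)"
    and g_range: "\<And>x. x \<in> level_points (width_above n s) D \<Longrightarrow> g x \<in> {0..<int p}"
    and g0: "\<And>i. i < width_above n s \<Longrightarrow> [g (0, i) = extend s c v i] (mod int p)"
    and g_linked: "\<And>j. j < length D \<Longrightarrow>
      linked p (foldl width_above (width_above n s) (take j D)) (D ! j)
        (\<lambda>i. g (j, i)) (\<lambda>i. g (Suc j, i))"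
    using g by (auto simp: level_colorings_def PiE_def)
  note suc = prepend_level_Suc[OF ext]
  have "?f \<in> level_points n (s # D) \<rightarrow>\<^sub>E {0..<int p}"
  proof (rule PiE_I)
    fix x assume "x \<in> level_points n (s # D)"
    then show "?f x \<in> {0..<int p}"
      using g_range p
      by (cases x) (auto simp: level_points_Cons prepend_level_def split: nat.splits)
  qed (simp add: prepend_level_def)
  moreover have "linked p n s (\<lambda>i. ?f (0, i)) (\<lambda>i. ?f (Suc 0, i))"
  proof -
    have "linked p n s v (\<lambda>i. g (0, i))"
      unfolding linked_def using ok c g0 by blast
    then show ?thesis
      unfolding suc using wf
      by (subst linked_cong_below[where v = v]) (auto simp: prepend_level_0)
  qed
  ultimately show ?thesis
    using g_linked unfolding level_colorings_def
    by (auto simp: All_less_Suc2 suc prepend_level_0)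
qed

text \<open>A coloring amounts to the color chosen at the lowest slice together with a coloring of
  the rest; \<open>prepend_level\<close> is the bijection from the disjoint union over the
  choices.\<close>

lemma card_level_colorings_Cons:
  assumes wf: "well_formed n (s # D)" and ok: "passable p s v" and p: "p > 0"
  shows "card (level_colorings p n (s # D) v) =
    (\<Sum>c\<in>new_colors p s. card (level_colorings p (width_above n s) D (extend s c v)))"
proof -
  let ?L = "\<lambda>c. level_colorings p (width_above n s) D (extend s c v)"
  let ?F = "\<lambda>(c, g). prepend_level n (s # D) (\<lambda>i. v i mod int p) g"
  have ext: "g \<in> extensional (level_points (width_above n s) D)" if "g \<in> ?L c" for g c
    using that by (auto simp: level_colorings_def PiE_def)
  have "inj_on ?F (Sigma (new_colors p s) ?L)"
  proof (rule inj_onI, clarify)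
    fix c d g h
    assume c: "c \<in> new_colors p s" "g \<in> ?L c" and d: "d \<in> new_colors p s" "h \<in> ?L d"
      and eq: "prepend_level n (s # D) (\<lambda>i. v i mod int p) g =
        prepend_level n (s # D) (\<lambda>i. v i mod int p) h"
    have "g (j, i) = h (j, i)" for j i
      using prepend_level_Suc[OF ext[OF c(2)]] prepend_level_Suc[OF ext[OF d(2)]] eq by metis
    then have gh: "g = h" by auto
    \<comment> \<open>At a minimum the choice can be read off from \<open>g\<close> at position
      \<open>i\<close> of its lowest line; otherwise there is only the dummy choice.\<close>
    have "c = d"
    proof (cases s)
      case (Birth i)
      then have i: "i < width_above n s"
        using wf by (auto simp: width_above_def)
      have "[g (0, i) = extend s c v i] (mod int p)" "[h (0, i) = extend s d v i] (mod int p)"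
        using c d i by (auto simp: level_colorings_def)
      then have "[c = d] (mod int p)"
        using gh Birth by (auto intro: cong_trans cong_sym)
      then show ?thesis using c d Birth by (auto simp: cong_def)
    qed (use c d in auto)
    then show "c = d \<and> g = h" using gh by simp
  qed
  moreover have "?F ` Sigma (new_colors p s) ?L = level_colorings p n (s # D) v"
  proof (intro equalityI subsetI)
    fix f assume "f \<in> ?F ` Sigma (new_colors p s) ?L"
    then show "f \<in> level_colorings p n (s # D) v"
      using prepend_level_in_level_colorings[OF wf ok _ _ p] by auto
  next
    fix f assume f: "f \<in> level_colorings p n (s # D) v"
    then have f_ext: "f \<in> extensional (level_points n (s # D))"
      and f_range: "\<And>x. x \<in> level_points n (s # D) \<Longrightarrow> f x \<in> {0..<int p}"
      and f0: "\<And>i. i < n \<Longrightarrow> [f (0, i) = v i] (mod int p)"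
      and f_linked: "\<And>j. j < length (s # D) \<Longrightarrow>
        linked p (foldl width_above n (take j (s # D))) ((s # D) ! j)
          (\<lambda>i. f (j, i)) (\<lambda>i. f (Suc j, i))"
      by (auto simp: level_colorings_def PiE_def)
    define g where "g = (\<lambda>(j, i). f (Suc j, i))"
    have g_ext: "g \<in> extensional (level_points (width_above n s) D)"
      using f_ext by (auto simp: extensional_def g_def level_points_Cons)
    have "linked p n s (\<lambda>i. f (0, i)) (\<lambda>i. f (Suc 0, i))"
      using f_linked[of 0] by simp
    then have "linked p n s v (\<lambda>i. f (Suc 0, i))"
      using f0 wf by (subst (asm) linked_cong_below[where v = v]) auto
    then obtain c where c: "c \<in> new_colors p s"
      "\<And>k. k < width_above n s \<Longrightarrow> [f (Suc 0, k) = extend s c v k] (mod int p)"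
      by (auto simp: linked_def)
    have "g \<in> ?L c"
      unfolding level_colorings_def
      using g_ext f_range c(2) f_linked[of "Suc j" for j]
      by (auto simp: g_def PiE_def level_points_Cons)
    moreover have "?F (c, g) = f"
    proof
      fix x show "?F (c, g) x = f x"
      proof (cases "x \<in> level_points n (s # D)")
        case True
        show ?thesis
        proof (cases x)
          case (Pair j i)
          show ?thesis
          proof (cases j)
            case 0
            then have "i < n" using True Pair by (simp add: level_points_Cons)
            then have "v i mod int p = f (0, i) mod int p"
              using f0 by (simp add: cong_def)
            also have "\<dots> = f (0, i)"
              using f_range[of "(0, i)"] True Pair 0 by auto
            finally show ?thesis using Pair 0 \<open>i < n\<close> by (simp add: prepend_level_0)
          next
            case (Suc k)
            then show ?thesis using Pair prepend_level_Suc[OF g_ext] by (simp add: g_def)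
          qed
        qed
      next
        case False
        then show ?thesis
          using extensional_arb[OF f_ext] by (simp add: prepend_level_def)
      qed
    qed
    ultimately show "f \<in> ?F ` Sigma (new_colors p s) ?L"
      using c(1) by (metis (no_types, lifting) SigmaI image_eqI)
  qed
  ultimately have "card (level_colorings p n (s # D) v) = card (Sigma (new_colors p s) ?L)"
    by (metis card_image)
  also have "\<dots> = (\<Sum>c\<in>new_colors p s. card (?L c))"
    by (rule card_SigmaI) (auto simp: finite_level_colorings)
  finally show ?thesis .
qed

lemma card_level_colorings:
  assumes "well_formed n D" and p: "p > 0"
  shows "card (level_colorings p n D v) = completions p D v"
  using assms(1)
proof (induction D arbitrary: n v)
  case Nil
  then have "level_points n [] = {}" by (simp add: level_points_def)
  then have "level_colorings p n [] v = {\<lambda>x. undefined}"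
    using Nil by (auto simp: level_colorings_def)
  then show ?case by simp
next
  case (Cons s D)
  show ?case
  proof (cases "passable p s v")
    case True
    then show ?thesis
      using card_level_colorings_Cons[OF Cons.prems True p] Cons.IH Cons.prems by simp
  next
    case False
    have "f \<notin> level_colorings p n (s # D) v" for f
    proof
      assume f: "f \<in> level_colorings p n (s # D) v"
      then have "linked p n s (\<lambda>i. f (0, i)) (\<lambda>i. f (Suc 0, i))"
        by (auto simp: level_colorings_def)
      moreover have "\<And>i. i < n \<Longrightarrow> [f (0, i) = v i] (mod int p)"
        using f by (auto simp: level_colorings_def)
      ultimately have "linked p n s v (\<lambda>i. f (Suc 0, i))"
        using Cons.prems linked_cong_below[of s n "\<lambda>i. f (0, i)" v] by simp
      then show False using False by (simp add: linked_def)
    qed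
    then have "level_colorings p n (s # D) v = {}" by blast
    then show ?thesis using False by simp
  qed
qed

section \<open>Arc and crossing conditions within one slice\<close>

definition crossing_rule :: "nat \<Rightarrow> slice \<Rightarrow> (nat \<Rightarrow> int) \<Rightarrow> (nat \<Rightarrow> int) \<Rightarrow> bool" where
  "crossing_rule p s x y \<longleftrightarrow> (\<forall>i.
     (s = Cross True i \<longrightarrow> [x (Suc i) + y i - 2 * x i = 0] (mod int p)) \<and>
     (s = Cross False i \<longrightarrow> [x i + y (Suc i) - 2 * x (Suc i) = 0] (mod int p)))"

text \<open>Collects the equalities that \<open>over_joined\<close> imposes in one slice; the
  understrand is left to \<open>crossing_rule\<close>.\<close>

definition over_rule :: "nat \<Rightarrow> slice \<Rightarrow> (nat \<Rightarrow> int) \<Rightarrow> (nat \<Rightarrow> int) \<Rightarrow> bool" where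
  "over_rule n s x y \<longleftrightarrow>
     (\<forall>i<pos s. y i = x i) \<and>
     (\<forall>i. pos s + ins s \<le> i \<longrightarrow> i < n \<longrightarrow> y (i - ins s + outs s) = x i) \<and>
     (case s of Birth i \<Rightarrow> y i = y (Suc i) | Death i \<Rightarrow> x i = x (Suc i)
      | Cross c i \<Rightarrow> if c then y (Suc i) = x i else y i = x (Suc i))"

text \<open>Between representatives in \<open>{0..<int p}\<close> congruence is equality, so every
  clause of \<open>linked\<close> but the one for an outgoing understrand becomes an equality along
  an arc. The remaining clause is the crossing relation solved for the outgoing color.\<close>

lemma linked_iff:
  assumes n: "pos s + ins s \<le> n"
    and x: "\<And>i. i < n \<Longrightarrow> x i \<in> {0..<int p}"
    and y: "\<And>i. i < width_above n s \<Longrightarrow> y i \<in> {0..<int p}"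
  shows "linked p n s x y \<longleftrightarrow> over_rule n s x y \<and> crossing_rule p s x y"
proof -
  have eq: "[a = b] (mod int p) \<longleftrightarrow> a = b" if "a \<in> {0..<int p}" "b \<in> {0..<int p}" for a b
    using that by (auto simp: cong_def)
  have xy: "[y k = x i] (mod int p) \<longleftrightarrow> y k = x i" if "k < width_above n s" "i < n" for k i
    using that x y eq by blast
  show ?thesis
  proof (cases s)
    case (Birth i)
    have "linked p n s x y \<longleftrightarrow> (\<exists>c\<in>{0..<int p}. \<forall>k<n + 2.
        y k = (if k < i then x k else if k < i + 2 then c else x (k - 2)))"
      unfolding linked_def Birth using n xy y Birth
      by (auto simp: width_above_def eq intro!: bex_cong)
    also have "\<dots> \<longleftrightarrow> over_rule n s x y \<and> crossing_rule p s x y"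
    proof (safe)
      fix c assume *: "\<forall>k<n + 2. y k = (if k < i then x k else if k < i + 2 then c else x (k - 2))"
      show "over_rule n s x y"
        using n * unfolding over_rule_def Birth by auto
      show "crossing_rule p s x y"
        by (simp add: crossing_rule_def Birth)
    next
      assume *: "over_rule n s x y"
      have "y k = (if k < i then x k else if k < i + 2 then y i else x (k - 2))" if k: "k < n + 2" for k
      proof -
        consider "k < i" | "k = i" | "k = Suc i" | "k \<ge> i + 2" by linarith
        then show ?thesis
        proof cases
          case 4
          then obtain m where m: "k = i + 2 + m"
            using le_Suc_ex by blast
          then have "y (i + m + 2) = x (i + m)"
            using * k unfolding over_rule_def Birth by simp
          then show ?thesis using m by (simp add: ac_simps)
        qed (use * in \<open>auto simp: over_rule_def Birth\<close>)
      qed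
      moreover have "y i \<in> {0..<int p}" using y n Birth by (simp add: width_above_def)
      ultimately show "\<exists>c\<in>{0..<int p}. \<forall>k<n + 2. y k = (if k < i then x k else if k < i + 2 then c else x (k - 2))"
        by blast
    qed
    finally show ?thesis .
  next
    case (Death i)
    have y_iff: "[y k = extend s 0 x k] (mod int p) \<longleftrightarrow> y k = (if k < i then x k else x (k + 2))"
      if "k < n - 2" for k
      using that n xy[of k k] xy[of k "k + 2"] by (simp add: Death width_above_def)
    have x_iff: "[x i = x (Suc i)] (mod int p) \<longleftrightarrow> x i = x (Suc i)"
      using n by (intro eq x) (auto simp: Death)
    have "linked p n s x y \<longleftrightarrow> [x i = x (Suc i)] (mod int p) \<and>
        (\<forall>k<n - 2. [y k = extend s 0 x k] (mod int p))"
      by (simp add: linked_def Death width_above_def del: extend.simps)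
    also have "\<dots> \<longleftrightarrow> x i = x (Suc i) \<and> (\<forall>k<n - 2. y k = (if k < i then x k else x (k + 2)))"
      unfolding x_iff by (intro conj_cong refl all_cong y_iff)
    also have "\<dots> \<longleftrightarrow> over_rule n s x y \<and> crossing_rule p s x y"
    proof
      assume A: "x i = x (Suc i) \<and> (\<forall>k<n - 2. y k = (if k < i then x k else x (k + 2)))"
      note eq = A[THEN conjunct1]
      note * = A[THEN conjunct2, rule_format]
      have "y (k - 2) = x k" if k: "i + 2 \<le> k" "k < n" for k
      proof -
        obtain m where m: "k = i + 2 + m"
          using k(1) le_Suc_ex by blast
        then show ?thesis
          using *[of "i + m"] k by (simp add: ac_simps)
      qed
      moreover have "y k = x k" if "k < i" for k
        using *[of k] n Death that by simp
      ultimately have "over_rule n s x y"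
        using eq by (simp add: over_rule_def Death)
      then show "over_rule n s x y \<and> crossing_rule p s x y"
        by (simp add: crossing_rule_def Death)
    next
      assume *: "over_rule n s x y \<and> crossing_rule p s x y"
      have "y k = (if k < i then x k else x (k + 2))" if "k < n - 2" for k
      proof -
        have "i + 2 \<le> k + 2 \<longrightarrow> k + 2 < n \<longrightarrow> y (k + 2 - 2 + 0) = x (k + 2)"
          using * unfolding over_rule_def Death pos.simps ins.simps outs.simps by blast
        then show ?thesis
          using * that by (simp add: over_rule_def Death)
      qed
      then show "x i = x (Suc i) \<and> (\<forall>k<n - 2. y k = (if k < i then x k else x (k + 2)))"
        using * by (simp add: over_rule_def Death)
    qed
    finally show ?thesis .
  next
    case (Cross c i)
    have wa: "width_above n s = n"
      using n by (simp add: Cross width_above_def)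
    have "linked p n s x y \<longleftrightarrow> (\<forall>k<n. [y k = extend s 0 x k] (mod int p))"
      unfolding linked_def wa by (simp add: Cross del: extend.simps)
    \<comment> \<open>The two positions at the crossing are separated from the others, which are
      then split into left and right to match \<open>over_rule\<close>.\<close>
    also have "\<dots> \<longleftrightarrow> (\<forall>k<n. k \<noteq> i \<longrightarrow> k \<noteq> Suc i \<longrightarrow> y k = x k) \<and>
        [y i = extend s 0 x i] (mod int p) \<and> [y (Suc i) = extend s 0 x (Suc i)] (mod int p)"
    proof -
      have "i < n" "Suc i < n" using n Cross by auto
      then have split: "(\<forall>k<n. P k) \<longleftrightarrow> (\<forall>k<n. k \<noteq> i \<longrightarrow> k \<noteq> Suc i \<longrightarrow> P k) \<and> P i \<and> P (Suc i)" for P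
        by blast
      have "[y k = extend s 0 x k] (mod int p) \<longleftrightarrow> y k = x k"
        if "k < n" "k \<noteq> i" "k \<noteq> Suc i" for k
        using that n xy[of k k] by (simp add: Cross width_above_def)
      then show ?thesis by (subst split) blast
    qed
    also have "(\<forall>k<n. k \<noteq> i \<longrightarrow> k \<noteq> Suc i \<longrightarrow> y k = x k) \<longleftrightarrow>
       (\<forall>k<i. y k = x k) \<and> (\<forall>k. i + 2 \<le> k \<longrightarrow> k < n \<longrightarrow> y k = x k)"
    proof -
      have "k < n \<and> k \<noteq> i \<and> k \<noteq> Suc i \<longleftrightarrow> k < i \<or> i + 2 \<le> k \<and> k < n" for k
        using n Cross by auto
      then show ?thesis by metis
    qed
    also have "(\<forall>k. i + 2 \<le> k \<longrightarrow> k < n \<longrightarrow> y k = x k) \<longleftrightarrow>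
        (\<forall>k. pos s + ins s \<le> k \<longrightarrow> k < n \<longrightarrow> y (k - ins s + outs s) = x k)"
    proof -
      have "k - 2 + 2 = k" if "i + 2 \<le> k" for k :: nat
        using that by simp
      then show ?thesis by (simp add: Cross)
    qed
    finally have linked: "linked p n s x y \<longleftrightarrow>
       ((\<forall>k<i. y k = x k) \<and>
        (\<forall>k. pos s + ins s \<le> k \<longrightarrow> k < n \<longrightarrow> y (k - ins s + outs s) = x k)) \<and>
       [y i = extend s 0 x i] (mod int p) \<and> [y (Suc i) = extend s 0 x (Suc i)] (mod int p)" .
    have rule: "[a + b - 2 * d = 0] (mod int p) \<longleftrightarrow> [b = 2 * d - a] (mod int p)" for a b d
      by (simp add: cong_iff_dvd_diff algebra_simps)
    have over: "[y (Suc i) = x i] (mod int p) \<longleftrightarrow> y (Suc i) = x i"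
      "[y i = x (Suc i)] (mod int p) \<longleftrightarrow> y i = x (Suc i)"
      using n xy wa by (auto simp: Cross)
    show ?thesis
      unfolding linked over_rule_def crossing_rule_def rule
      by (cases c) (auto simp: Cross over)
  qed
qed

section \<open>Colorings of the strands\<close>

definition constant_along :: "('a \<Rightarrow> 'a \<Rightarrow> bool) \<Rightarrow> ('a \<Rightarrow> 'b) \<Rightarrow> bool" where
  "constant_along R f \<longleftrightarrow> (\<forall>x y. R x y \<longrightarrow> f x = f y)"

lemma constant_along_equivclp:
  assumes "constant_along R f" "equivclp R x y"
  shows "f x = f y"
  using assms(2)
  by (induction rule: equivclp_induct) (use assms(1) in \<open>auto simp: constant_along_def\<close>)

lemma constant_along_over_joined_iff:
  fixes f :: "point \<Rightarrow> int"
  shows "constant_along (over_joined D) f \<longleftrightarrow>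
     (\<forall>j<length D. over_rule (width D j) (D ! j) (\<lambda>i. f (j, i)) (\<lambda>i. f (Suc j, i)))"
    (is "?L \<longleftrightarrow> ?R")
proof
  assume ?L
  then have *: "over_joined D x y \<Longrightarrow> f x = f y" for x y
    unfolding constant_along_def by blast
  show ?R
  proof (intro allI impI)
    fix j assume j: "j < length D"
    have "case D ! j of Birth i \<Rightarrow> f (Suc j, i) = f (Suc j, Suc i) | Death i \<Rightarrow> f (j, i) = f (j, Suc i)
      | Cross c i \<Rightarrow> if c then f (Suc j, Suc i) = f (j, i) else f (Suc j, i) = f (j, Suc i)"
    proof (cases "D ! j")
      case (Birth i)
      then show ?thesis using *[OF over_joined.birth[OF j Birth]] by simp
    next
      case (Death i)
      then show ?thesis using *[OF over_joined.death[OF j Death]] by simp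
    next
      case (Cross c i)
      then show ?thesis
        using *[OF over_joined.cross_rising[OF j, of i]] *[OF over_joined.cross_falling[OF j, of i]]
        by (cases c) simp_all
    qed
    then show "over_rule (width D j) (D ! j) (\<lambda>i. f (j, i)) (\<lambda>i. f (Suc j, i))"
      using *[OF over_joined.left[OF j]] *[OF over_joined.right[OF j]]
      unfolding over_rule_def by metis
  qed
next
  assume R: ?R
  have "f x = f y" if "over_joined D x y" for x y
    using that
  proof cases
    case (left j i)
    then show ?thesis using R by (simp add: over_rule_def)
  next
    case (right j i)
    then show ?thesis using R by (simp add: over_rule_def)
  next
    case (birth j i)
    have "over_rule (width D j) (D ! j) (\<lambda>i. f (j, i)) (\<lambda>i. f (Suc j, i))"
      using R birth by blast
    then show ?thesis using birth by (simp add: over_rule_def)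
  next
    case (death j i)
    have "over_rule (width D j) (D ! j) (\<lambda>i. f (j, i)) (\<lambda>i. f (Suc j, i))"
      using R death by blast
    then show ?thesis using death by (simp add: over_rule_def)
  next
    case (cross_rising j i)
    have "over_rule (width D j) (D ! j) (\<lambda>i. f (j, i)) (\<lambda>i. f (Suc j, i))"
      using R cross_rising by blast
    then show ?thesis using cross_rising by (simp add: over_rule_def)
  next
    case (cross_falling j i)
    have "over_rule (width D j) (D ! j) (\<lambda>i. f (j, i)) (\<lambda>i. f (Suc j, i))"
      using R cross_falling by blast
    then show ?thesis using cross_falling by (simp add: over_rule_def)
  qed
  then show ?L
    unfolding constant_along_def by blast
qed

lemma width_Suc: "j < length D \<Longrightarrow> width D (Suc j) = width_above (width D j) (D ! j)"
  by (simp add: width_def take_Suc_conv_app_nth)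

text \<open>The width conditions of a diagram keep both ends in range; hence restricting colors to
  \<open>points D\<close> preserves constancy along strands.\<close>

lemma over_joined_points:
  assumes "diagram D" "over_joined D x y"
  shows "x \<in> points D \<and> y \<in> points D"
proof -
  have w: "pos (D ! j) + ins (D ! j) \<le> width D j" if "j < length D" for j
    using assms(1) that by (simp add: diagram_def)
  show ?thesis
    using assms(2)
  proof cases
    case (left j i) then show ?thesis
      using w[of j] by (auto simp: points_def width_Suc width_above_def)
  next
    case (right j i) then show ?thesis
      using w[of j] by (auto simp: points_def width_Suc width_above_def)
  next
    case (birth j i) then show ?thesis
      using w[of j] by (auto simp: points_def width_Suc width_above_def)
  next
    case (death j i) then show ?thesis
      using w[of j] by (auto simp: points_def width_Suc width_above_def)
  next
    case (cross_rising j i) then show ?thesis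
      using w[of j] by (auto simp: points_def width_Suc width_above_def)
  next
    case (cross_falling j i) then show ?thesis
      using w[of j] by (auto simp: points_def width_Suc width_above_def)
  qed
qed

lemma crossing_points:
  assumes "diagram D" "j < length D" "D ! j = Cross c i"
  shows "(j, i) \<in> points D" "(j, Suc i) \<in> points D"
    "(Suc j, i) \<in> points D" "(Suc j, Suc i) \<in> points D"
proof -
  have "i + 2 \<le> width D j"
    using assms by (auto simp: diagram_def)
  then show "(j, i) \<in> points D" "(j, Suc i) \<in> points D"
    "(Suc j, i) \<in> points D" "(Suc j, Suc i) \<in> points D"
    using assms(2,3) by (auto simp: points_def width_Suc width_above_def)
qed

lemma level_colorings_iff:
  assumes D: "diagram D"
  shows "f \<in> level_colorings p 0 D v \<longleftrightarrow>
     f \<in> points D \<rightarrow>\<^sub>E {0..<int p} \<and> constant_along (over_joined D) f \<and>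
     (\<forall>j<length D. crossing_rule p (D ! j) (\<lambda>i. f (j, i)) (\<lambda>i. f (Suc j, i)))"
proof -
  have "linked p (width D j) (D ! j) (\<lambda>i. f (j, i)) (\<lambda>i. f (Suc j, i)) \<longleftrightarrow>
     over_rule (width D j) (D ! j) (\<lambda>i. f (j, i)) (\<lambda>i. f (Suc j, i)) \<and>
     crossing_rule p (D ! j) (\<lambda>i. f (j, i)) (\<lambda>i. f (Suc j, i))"
    if "f \<in> points D \<rightarrow>\<^sub>E {0..<int p}" "j < length D" for j
  proof (rule linked_iff)
    show "pos (D ! j) + ins (D ! j) \<le> width D j"
      using D that by (simp add: diagram_def)
    show "f (j, i) \<in> {0..<int p}" if "i < width D j" for i
      using \<open>f \<in> _\<close> \<open>j < _\<close> that by (auto simp: points_def PiE_def Pi_def)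
    show "f (Suc j, i) \<in> {0..<int p}" if "i < width_above (width D j) (D ! j)" for i
      using \<open>f \<in> _\<close> \<open>j < _\<close> that by (auto simp: points_def PiE_def Pi_def width_Suc)
  qed
  moreover have "level_points 0 D = points D"
    by (simp add: level_points_def points_def width_def)
  ultimately show ?thesis
    unfolding level_colorings_def constant_along_over_joined_iff by (auto simp: width_def)
qed

text \<open>Strands are the classes of points under \<open>over_joined\<close>, so pulling back
  along \<open>strand D\<close> identifies colorings of strands with colorings of points. The colors
  \<open>v\<close> are arbitrary because the lowest line meets no strand.\<close>

lemma card_colorings:
  assumes D: "diagram D" and "p > 0"
  shows "card (colorings p D) = completions p D v"
proof -
  let ?F = "\<lambda>a. restrict (\<lambda>x. a (strand D x)) (points D)"
  have strand_eq: "strand D x = strand D y" if "over_joined D x y" for x y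
    using that unfolding strand_def
    by (auto intro: equivclp_trans equivclp_sym r_into_equivclp)
  have colorings_iff: "a \<in> colorings p D \<longleftrightarrow> a \<in> strands D \<rightarrow>\<^sub>E {0..<int p} \<and>
      (\<forall>j<length D. crossing_rule p (D ! j) (\<lambda>i. a (strand D (j, i))) (\<lambda>i. a (strand D (Suc j, i))))"
    for a by (simp add: colorings_def crossing_rule_def)
  have crossing_cong: "crossing_rule p (D ! j) (\<lambda>i. f (j, i)) (\<lambda>i. f (Suc j, i)) \<longleftrightarrow>
      crossing_rule p (D ! j) (\<lambda>i. g (j, i)) (\<lambda>i. g (Suc j, i))"
    if "j < length D" "\<And>x. x \<in> points D \<Longrightarrow> f x = g x" for f g j
  proof (cases "D ! j")
    case (Cross c i)
    then show ?thesis
      using that(2) crossing_points[OF D that(1) Cross] by (auto simp: crossing_rule_def)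
  qed (simp_all add: crossing_rule_def)
  have "bij_betw ?F (colorings p D) (level_colorings p 0 D v)"
    unfolding bij_betw_def
  proof (intro conjI equalityI subsetI inj_onI)
    fix a b assume ab: "a \<in> colorings p D" "b \<in> colorings p D" "?F a = ?F b"
    have "a S = b S" if S: "S \<in> strands D" for S
    proof -
      obtain x where x: "x \<in> points D" "S = strand D x"
        using S unfolding strands_def by blast
      have "?F a x = ?F b x" using ab(3) by simp
      then show ?thesis using x by simp
    qed
    then show "a = b"
      using ab(1,2) by (auto simp: colorings_iff intro: PiE_ext)
  next
    fix f assume "f \<in> ?F ` colorings p D"
    then obtain a where a: "a \<in> colorings p D" and f: "f = ?F a" by blast
    have "constant_along (over_joined D) f"
      unfolding constant_along_def f using strand_eq over_joined_points[OF D] by auto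
    moreover have "f \<in> points D \<rightarrow>\<^sub>E {0..<int p}"
      unfolding f using a by (auto simp: colorings_iff strands_def PiE_def Pi_def)
    moreover have "crossing_rule p (D ! j) (\<lambda>i. f (j, i)) (\<lambda>i. f (Suc j, i))"
      if "j < length D" for j
      using a that crossing_cong[OF that, of f "\<lambda>x. a (strand D x)"] by (simp add: colorings_iff f)
    ultimately show "f \<in> level_colorings p 0 D v"
      by (simp add: level_colorings_iff[OF D])
  next
    fix f assume "f \<in> level_colorings p 0 D v"
    then have f: "f \<in> points D \<rightarrow>\<^sub>E {0..<int p}" "constant_along (over_joined D) f"
      "\<And>j. j < length D \<Longrightarrow> crossing_rule p (D ! j) (\<lambda>i. f (j, i)) (\<lambda>i. f (Suc j, i))"
      by (simp_all add: level_colorings_iff[OF D])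
    \<comment> \<open>Any point of the strand may serve, since \<open>f\<close> is constant on
      it.\<close>
    define a where "a = restrict (\<lambda>S. f (SOME x. x \<in> S)) (strands D)"
    have a: "a (strand D x) = f x" if "x \<in> points D" for x
    proof -
      have "x \<in> strand D x" by (simp add: strand_def)
      then have "(SOME y. y \<in> strand D x) \<in> strand D x" by (rule someI)
      then have "f x = f (SOME y. y \<in> strand D x)"
        using constant_along_equivclp[OF f(2)] by (simp add: strand_def)
      then show ?thesis using that by (simp add: a_def strands_def)
    qed
    have "a \<in> strands D \<rightarrow>\<^sub>E {0..<int p}"
    proof (rule PiE_I)
      fix S assume "S \<in> strands D"
      then show "a S \<in> {0..<int p}" using a f(1) by (auto simp: strands_def PiE_def Pi_def)
    qed (simp add: a_def)
    moreover have "crossing_rule p (D ! j) (\<lambda>i. a (strand D (j, i))) (\<lambda>i. a (strand D (Suc j, i)))"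
      if "j < length D" for j
      using f(3) that crossing_cong[OF that, of f "\<lambda>x. a (strand D x)"] a by simp
    ultimately have "a \<in> colorings p D" by (simp add: colorings_iff)
    moreover have "?F a = f"
      using f(1) a by (auto simp: PiE_def extensional_def)
    ultimately show "f \<in> ?F ` colorings p D" by (metis image_eqI)
  qed
  then have "card (colorings p D) = card (level_colorings p 0 D v)"
    by (rule bij_betw_same_card)
  then show ?thesis
    using card_level_colorings[of 0 D p v] assms by (simp add: diagram_iff_well_formed)
qed

section \<open>Invariance of the number of colorings\<close>

lemma diagram_equivclp_move:
  assumes "equivclp move D E" "diagram D" "p > 0"
  shows "diagram E \<and> completions p E v = completions p D v"
  using assms(1)
proof (induction rule: equivclp_induct)
  case (step E F)
  have "diagram X \<and> diagram Y" if "move X Y" for X Y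
    using that by cases auto
  then show ?case
    using step completions_move[OF _ assms(3)] by metis
qed (use assms in simp)

text \<open>All diagrams of \<open>K\<close> are connected by moves and share one count, so the
  description in \<open>col\<close> determines a unique number.\<close>

lemma col_eq_completions:
  assumes "K \<in> knots" "D \<in> K" "p > 0"
  shows "diagram D" "col p K = completions p D v"
proof -
  obtain D0 where D0: "diagram D0" "K = knot_type D0"
    using assms(1) by (auto simp: knots_def knot_diagram_def)
  have all: "diagram E \<and> completions p E v = completions p D0 v" if "E \<in> K" for E
    by (rule diagram_equivclp_move) (use that D0 assms(3) in \<open>auto simp: knot_type_def\<close>)
  then show "diagram D" using assms(2) by blast
  have eq: "card (colorings p E) = completions p D v" if "E \<in> K" for E
    using all[OF that] all[OF assms(2)] card_colorings[OF _ assms(3), of E v] by simp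
  show "col p K = completions p D v"
    unfolding col_def by (rule the_equality) (use eq assms(2) in auto)
qed

section \<open>Colorings of a symmetric union\<close>

text \<open>Keeps only the width conditions of \<open>diagram_with_disks\<close>, in recursive form;
  a disk needs a rightmost strand to sit on.\<close>

fun well_formed_items :: "nat \<Rightarrow> item list \<Rightarrow> bool" where
  "well_formed_items n [] \<longleftrightarrow> n = 0"
| "well_formed_items n (Slice s # T) \<longleftrightarrow>
     pos s + ins s \<le> n \<and> well_formed_items (width_above n s) T"
| "well_formed_items n (Disk_Inf # T) \<longleftrightarrow> n > 0 \<and> well_formed_items n T"
| "well_formed_items n (Disk_Twist k # T) \<longleftrightarrow> n > 0 \<and> well_formed_items n T"

lemma well_formed_itemsI:
  assumes "well_formed n (underlying T)"
    and "\<And>j. j < length T \<Longrightarrow> T ! j \<in> insert Disk_Inf (range Disk_Twist) \<Longrightarrow>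
      foldl width_above n (underlying (take j T)) > 0"
  shows "well_formed_items n T"
  using assms
proof (induction T arbitrary: n rule: underlying.induct)
  case (2 s T)
  have "foldl width_above (width_above n s) (underlying (take j T)) > 0"
    if "j < length T" "T ! j \<in> insert Disk_Inf (range Disk_Twist)" for j
    using "2.prems"(2)[of "Suc j"] that by simp
  then show ?case using "2.IH" "2.prems"(1) by simp
next
  case (3 T)
  have "foldl width_above n (underlying (take j T)) > 0"
    if "j < length T" "T ! j \<in> insert Disk_Inf (range Disk_Twist)" for j
    using "3.prems"(2)[of "Suc j"] that by simp
  then show ?case using "3.IH" "3.prems"(1) "3.prems"(2)[of 0] by simp
next
  case (4 k T)
  have "foldl width_above n (underlying (take j T)) > 0"
    if "j < length T" "T ! j \<in> insert Disk_Inf (range Disk_Twist)" for j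
    using "4.prems"(2)[of "Suc j"] that by simp
  then show ?case using "4.IH" "4.prems"(1) "4.prems"(2)[of 0] by simp
qed simp

lemma well_formed_underlying:
  "well_formed_items n T \<Longrightarrow> well_formed n (underlying T)"
  by (induction n T rule: well_formed_items.induct) auto

text \<open>
  Colorings of \<open>D\<close>, given by the lists of colors introduced at its slices, where at the disk
  \<open>Disk_Inf\<close> a color \<open>a\<close> may be replaced by any element of \<open>X a\<close>: with \<open>free_axis p\<close> these are the
  colorings of \<open>D\<close> cut open at the disk, with \<open>fixed_axis p t\<close> the colorings of \<open>D\<close> having color
  \<open>t\<close> there.
\<close>

fun disk_paths :: "nat \<Rightarrow> (int \<Rightarrow> int set) \<Rightarrow> nat \<Rightarrow> item list \<Rightarrow> (nat \<Rightarrow> int) \<Rightarrow> int list set" where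
  "disk_paths p X n [] u = {[]}"
| "disk_paths p X n (Slice s # T) u =
     (if passable p s u
      then \<Union>c\<in>new_colors p s. (#) c ` disk_paths p X (width_above n s) T (extend s c u) else {})"
| "disk_paths p X n (Disk_Inf # T) u =
     (\<Union>c\<in>X (u (n - 1)). (#) c ` disk_paths p X n T (u(n - 1 := c)))"
| "disk_paths p X n (Disk_Twist k # T) u = disk_paths p X n T u"

abbreviation free_axis :: "nat \<Rightarrow> int \<Rightarrow> int set" where
  "free_axis p a \<equiv> {0..<int p}"

definition fixed_axis :: "nat \<Rightarrow> int \<Rightarrow> int \<Rightarrow> int set" where
  "fixed_axis p t a = (if [a = t] (mod int p) then {t} else {})"

text \<open>
  Colorings of the symmetric union in the coordinates \<open>w\<close> (right half) and \<open>e\<close> (left minus right half).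
\<close>

fun union_paths :: "nat \<Rightarrow> nat \<Rightarrow> item list \<Rightarrow> (nat \<Rightarrow> int) \<Rightarrow> (nat \<Rightarrow> int) \<Rightarrow> (int \<times> int) list set" where
  "union_paths p n [] w e = {[]}"
| "union_paths p n (Slice s # T) w e =
     (if passable p s w \<and> passable p s e
      then \<Union>(c, d)\<in>new_colors p s \<times> new_colors p s.
        (#) (c, d) ` union_paths p (width_above n s) T (extend s c w) (extend s d e) else {})"
| "union_paths p n (Disk_Inf # T) w e =
     (if [e (n - 1) = 0] (mod int p)
      then \<Union>c\<in>{0..<int p}.
        (#) (c, 0) ` union_paths p n T (w(n - 1 := c)) (e(n - 1 := 0)) else {})"
| "union_paths p n (Disk_Twist k # T) w e =
     union_paths p n T (w(n - 1 := w (n - 1) + k * e (n - 1))) e"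

section \<open>Cardinalities of the sets of color lists\<close>

lemma card_UN_Cons:
  assumes "finite C" "\<And>c. c \<in> C \<Longrightarrow> finite (S c)" "inj_on g C"
  shows "card (\<Union>c\<in>C. (#) (g c) ` S c) = (\<Sum>c\<in>C. card (S c))"
proof -
  have "card (\<Union>c\<in>C. (#) (g c) ` S c) = (\<Sum>c\<in>C. card ((#) (g c) ` S c))"
    using assms by (intro card_UN_disjoint) (auto simp: inj_on_def)
  then show ?thesis by (simp add: card_image)
qed

lemma finite_disk_paths:
  assumes "\<And>a. finite (X a)"
  shows "finite (disk_paths p X n T u)"
  by (induction n T arbitrary: u rule: well_formed_items.induct) (use assms in auto)

lemma finite_fixed_axis [simp]: "finite (fixed_axis p t a)"
  by (simp add: fixed_axis_def)

lemma finite_union_paths: "finite (union_paths p n T w e)"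
  by (induction p n T w e rule: union_paths.induct) (auto simp: fun_upd_def)

lemma card_disk_paths_Slice:
  assumes "\<And>a. finite (X a)"
  shows "card (disk_paths p X n (Slice s # T) u) = (if passable p s u
     then \<Sum>c\<in>new_colors p s. card (disk_paths p X (width_above n s) T (extend s c u)) else 0)"
  using card_UN_Cons[of "new_colors p s" _ "\<lambda>c. c"] finite_disk_paths[of X, OF assms] by simp

lemma card_disk_paths_Inf:
  assumes "\<And>a. finite (X a)"
  shows "card (disk_paths p X n (Disk_Inf # T) u) =
     (\<Sum>c\<in>X (u (n - 1)). card (disk_paths p X n T (u(n - 1 := c))))"
  using card_UN_Cons[of "X (u (n - 1))" _ "\<lambda>c. c"] finite_disk_paths[of X, OF assms] assms by simp

lemma card_union_paths_Slice:
  "card (union_paths p n (Slice s # T) w e) = (if passable p s w \<and> passable p s e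
     then \<Sum>c\<in>new_colors p s. \<Sum>d\<in>new_colors p s.
       card (union_paths p (width_above n s) T (extend s c w) (extend s d e)) else 0)"
proof -
  let ?N = "new_colors p s"
  let ?U = "\<lambda>(c, d). union_paths p (width_above n s) T (extend s c w) (extend s d e)"
  have "card (\<Union>x\<in>?N \<times> ?N. (#) x ` ?U x) = (\<Sum>x\<in>?N \<times> ?N. card (?U x))"
    by (rule card_UN_Cons[where g = "\<lambda>x. x"]) (auto simp: finite_union_paths)
  then show ?thesis
    by (simp add: sum.cartesian_product case_prod_beta)
qed

lemma card_union_paths_Inf:
  "card (union_paths p n (Disk_Inf # T) w e) = (if [e (n - 1) = 0] (mod int p)
     then \<Sum>c\<in>{0..<int p}. card (union_paths p n T (w(n - 1 := c)) (e(n - 1 := 0))) else 0)"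
  using card_UN_Cons[of "{0..<int p}" "\<lambda>c. union_paths p n T (w(n - 1 := c)) (e(n - 1 := 0))"
      "\<lambda>c. (c, 0)"] by (simp add: finite_union_paths inj_on_def)

text \<open>The lists record only the chosen representatives, so congruent starting colors give the
  very same set and not merely one of equal size.\<close>

lemma disk_paths_cong:
  assumes "well_formed_items n T" "\<And>k. k < n \<Longrightarrow> [u k = v k] (mod int p)"
    and X: "\<And>a b. [a = b] (mod int p) \<Longrightarrow> X a = X b"
  shows "disk_paths p X n T u = disk_paths p X n T v"
  using assms(1,2)
proof (induction n T arbitrary: u v rule: well_formed_items.induct)
  case (2 n s T)
  have "disk_paths p X (width_above n s) T (extend s c u) =
      disk_paths p X (width_above n s) T (extend s c v)" for c
    using "2.prems" cong_extend_below[of s n u v p c c] by (intro "2.IH") auto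
  moreover have "passable p s u \<longleftrightarrow> passable p s v"
    using "2.prems" by (intro cong_passable_below) auto
  ultimately show ?case by simp
next
  case (3 n T)
  have "disk_paths p X n T (u(n - 1 := c)) = disk_paths p X n T (v(n - 1 := c))" for c
    using "3.prems" by (intro "3.IH") auto
  moreover have "X (u (n - 1)) = X (v (n - 1))"
    using "3.prems" by (intro X) auto
  ultimately show ?case by simp
qed auto

lemma fixed_axis_cong: "[a = b] (mod int p) \<Longrightarrow> fixed_axis p t a = fixed_axis p t b"
  by (auto simp: fixed_axis_def cong_def)

section \<open>Fibers over the difference of the two halves\<close>

text \<open>The evolution of \<open>e\<close> does not involve \<open>w\<close>: twists leave
  \<open>e\<close> alone, and \<open>Disk_Inf\<close> pins it to 0.\<close>

lemma map_snd_union_paths: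
  assumes "zs \<in> union_paths p n T w e"
  shows "map snd zs \<in> disk_paths p (fixed_axis p 0) n T e"
  using assms
proof (induction p n T w e arbitrary: zs rule: union_paths.induct)
  case (2 p n s T w e)
  then obtain c d ys where "zs = (c, d) # ys" "c \<in> new_colors p s" "d \<in> new_colors p s"
    "passable p s w \<and> passable p s e"
    "ys \<in> union_paths p (width_above n s) T (extend s c w) (extend s d e)"
    by (auto split: if_splits)
  then show ?case
    using "2.IH"[of "(c, d)" c d ys] by auto
next
  case (3 p n T w e)
  then obtain c ys where "zs = (c, 0) # ys" "c \<in> {0..<int p}" "[e (n - 1) = 0] (mod int p)"
    "ys \<in> union_paths p n T (w(n - 1 := c)) (e(n - 1 := 0))"
    by (auto split: if_splits)
  then show ?case
    using "3.IH"[of c ys] by (auto simp: fixed_axis_def fun_upd_def)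
qed auto

lemma extend_diff: "extend s (c - d) (\<lambda>k. u k - v k) k = extend s c u k - extend s d v k"
  by (cases s) (auto simp: algebra_simps)

lemma passable_diff:
  "passable p s u \<Longrightarrow> passable p s v \<Longrightarrow> passable p s (\<lambda>k. u k - v k)"
  by (cases s) (auto intro: cong_diff)

lemma passable_add:
  "passable p s u \<Longrightarrow> passable p s v \<Longrightarrow> passable p s (\<lambda>k. u k + v k)"
  by (cases s) (auto intro: cong_add)

text \<open>For fixed \<open>e\<close> a twist adds the same multiple of \<open>e\<close> to
  \<open>w\<close> and \<open>w'\<close>, so their difference passes it unchanged. At
  \<open>Disk_Inf\<close> both receive fresh colors, which makes the difference free there.\<close>

lemma union_paths_diff:
  assumes "well_formed_items n T" "p > 0"
    and "zs \<in> union_paths p n T w e" "zs' \<in> union_paths p n T w' e"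
    and "map snd zs = map snd zs'"
  shows "map2 (\<lambda>z z'. (fst z - fst z') mod int p) zs zs' \<in>
     disk_paths p (free_axis p) n T (\<lambda>k. w k - w' k)"
  using assms
proof (induction n T arbitrary: zs zs' w w' e rule: well_formed_items.induct)
  case (2 n s T)
  let ?m = "width_above n s"
  from "2.prems"(3) obtain c d ys where zs: "zs = (c, d) # ys" "c \<in> new_colors p s"
    "ys \<in> union_paths p ?m T (extend s c w) (extend s d e)" and ok: "passable p s w"
    by (auto split: if_splits)
  from "2.prems"(4,5) zs obtain c' ys' where zs': "zs' = (c', d) # ys'" "c' \<in> new_colors p s"
    "ys' \<in> union_paths p ?m T (extend s c' w') (extend s d e)" and ok': "passable p s w'"
    by (auto split: if_splits)
  let ?c = "(c - c') mod int p"
  let ?map = "map2 (\<lambda>z z'. (fst z - fst z') mod int p) ys ys'"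
  have wf: "well_formed_items ?m T" "pos s + ins s \<le> n"
    using "2.prems"(1) by auto
  have "?map \<in> disk_paths p (free_axis p) ?m T (\<lambda>k. extend s c w k - extend s c' w' k)"
    by (rule "2.IH"[OF wf(1) "2.prems"(2) zs(3) zs'(3)]) (use "2.prems"(5) zs zs' in simp)
  \<comment> \<open>Reducing the new color modulo \<open>p\<close> makes it an admissible list entry
    and changes colors only within their classes.\<close>
  also have "disk_paths p (free_axis p) ?m T (\<lambda>k. extend s c w k - extend s c' w' k) =
      disk_paths p (free_axis p) ?m T (extend s ?c (\<lambda>k. w k - w' k))"
  proof (rule disk_paths_cong)
    show "[extend s c w k - extend s c' w' k = extend s ?c (\<lambda>k. w k - w' k) k] (mod int p)" for k
      unfolding extend_diff[symmetric] by (rule cong_extend) auto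
  qed (use wf in auto)
  finally have "?map \<in> \<dots>" .
  moreover have "?c \<in> new_colors p s"
    using zs(2) zs'(2) "2.prems"(2) by (cases s) auto
  ultimately show ?case
    using passable_diff[OF ok ok'] zs zs' by auto
next
  case (3 n T)
  from "3.prems"(3) obtain c ys where zs: "zs = (c, 0) # ys"
    "ys \<in> union_paths p n T (w(n - 1 := c)) (e(n - 1 := 0))"
    by (auto split: if_splits)
  from "3.prems"(4) obtain c' ys' where zs': "zs' = (c', 0) # ys'"
    "ys' \<in> union_paths p n T (w'(n - 1 := c')) (e(n - 1 := 0))"
    by (auto split: if_splits)
  let ?c = "(c - c') mod int p"
  let ?map = "map2 (\<lambda>z z'. (fst z - fst z') mod int p) ys ys'"
  have wf: "well_formed_items n T"
    using "3.prems"(1) by auto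
  have "?map \<in> disk_paths p (free_axis p) n T (\<lambda>k. (w(n - 1 := c)) k - (w'(n - 1 := c')) k)"
    by (rule "3.IH"[OF wf "3.prems"(2) zs(2) zs'(2)]) (use "3.prems"(5) zs zs' in simp)
  also have "\<dots> = disk_paths p (free_axis p) n T ((\<lambda>k. w k - w' k)(n - 1 := ?c))"
    by (rule disk_paths_cong) (use wf in auto)
  finally show ?case
    using zs zs' "3.prems"(2) by auto
next
  case (4 n k T)
  have "map2 (\<lambda>z z'. (fst z - fst z') mod int p) zs zs' \<in> disk_paths p (free_axis p) n T
    (\<lambda>i. (w(n - 1 := w (n - 1) + k * e (n - 1))) i - (w'(n - 1 := w' (n - 1) + k * e (n - 1))) i)"
    by (rule "4.IH"[OF _ "4.prems"(2) "4.prems"(3,4)[unfolded union_paths.simps] "4.prems"(5)])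
      (use "4.prems"(1) in simp)
  also have "(\<lambda>i. (w(n - 1 := w (n - 1) + k * e (n - 1))) i - (w'(n - 1 := w' (n - 1) + k * e (n - 1))) i) =
     (\<lambda>i. w i - w' i)"
    by auto
  finally show ?case by simp
qed simp

lemma fst_union_paths:
  assumes "zs \<in> union_paths p n T w e" "z \<in> set zs" "p > 0"
  shows "fst z \<in> {0..<int p}"
  using assms(1,2)
proof (induction n T arbitrary: w e zs rule: well_formed_items.induct)
  case (2 n s T)
  have "new_colors p s \<subseteq> {0..<int p}"
    using assms(3) by (cases s) simp_all
  moreover obtain c d ys where "zs = (c, d) # ys" "c \<in> new_colors p s"
    "d \<in> new_colors p s" "passable p s w \<and> passable p s e"
    "ys \<in> union_paths p (width_above n s) T (extend s c w) (extend s d e)"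
    using "2.prems"(1) by (auto split: if_splits)
  ultimately show ?case
    using "2.IH"[of ys] "2.prems"(2) by auto
qed (use assms(3) in \<open>auto split: if_splits\<close>)

text \<open>Each fiber of \<open>map snd\<close> that is not empty injects into the colorings of the
  cut diagram by subtracting a fixed member; entries are representatives, so differences modulo
  \<open>p\<close> determine them.\<close>

lemma card_union_paths_le:
  assumes wf: "well_formed_items n T" and p: "p > 0"
  shows "card (union_paths p n T w e) \<le>
    card (disk_paths p (fixed_axis p 0) n T e) * card (disk_paths p (free_axis p) n T (\<lambda>_. 0))"
proof -
  let ?U = "union_paths p n T w e"
  let ?K = "disk_paths p (free_axis p) n T (\<lambda>_. 0)"
  have fin_K: "finite ?K"
    by (rule finite_disk_paths) simp
  have fiber: "card {zs \<in> ?U. map snd zs = ds} \<le> card ?K" for ds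
  proof (cases "{zs \<in> ?U. map snd zs = ds} = {}")
    case False
    then obtain zs' where zs': "zs' \<in> ?U" "map snd zs' = ds" by auto
    let ?f = "\<lambda>zs. map2 (\<lambda>z z'. (fst z - fst z') mod int p) zs zs'"
    have "?f zs \<in> ?K" if "zs \<in> ?U" "map snd zs = ds" for zs
      using union_paths_diff[OF wf p that(1) zs'(1)] that(2) zs'(2) by simp
    moreover have "inj_on ?f {zs \<in> ?U. map snd zs = ds}"
    proof (rule inj_onI, clarify)
      fix xs ys
      assume xs: "xs \<in> ?U" "ds = map snd xs" and ys: "ys \<in> ?U" "map snd ys = map snd xs"
        and eq: "?f xs = ?f ys"
      have len: "length xs = length zs'" "length ys = length zs'"
        using zs'(2) xs(2) ys(2) by (metis length_map)+
      show "xs = ys"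
      proof (rule nth_equalityI)
        fix j assume j: "j < length xs"
        have "?f xs ! j = ?f ys ! j" using eq by simp
        then have "[fst (xs ! j) - fst (zs' ! j) = fst (ys ! j) - fst (zs' ! j)] (mod int p)"
          using j len by (simp add: cong_def)
        then have "[fst (xs ! j) = fst (ys ! j)] (mod int p)"
          by (simp add: cong_iff_dvd_diff)
        moreover have "fst (xs ! j) \<in> {0..<int p}" "fst (ys ! j) \<in> {0..<int p}"
          using fst_union_paths[OF xs(1) _ p] fst_union_paths[OF ys(1) _ p] j len by auto
        ultimately have "fst (xs ! j) = fst (ys ! j)"
          by (simp add: cong_def)
        moreover have "snd (xs ! j) = snd (ys ! j)"
          using ys(2) j len by (metis nth_map)
        ultimately show "xs ! j = ys ! j" by (simp add: prod_eq_iff)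
      qed (use len in simp)
    qed
    ultimately show ?thesis
      using fin_K by (intro card_inj_on_le[of ?f]) auto
  next
    case True
    then show ?thesis by (metis card.empty le0)
  qed
  let ?E = "disk_paths p (fixed_axis p 0) n T e"
  have U: "?U = (\<Union>ds\<in>?E. {zs \<in> ?U. map snd zs = ds})"
    by (auto dest: map_snd_union_paths)
  have "card ?U \<le> (\<Sum>ds\<in>?E. card {zs \<in> ?U. map snd zs = ds})"
    by (subst U) (intro card_UN_le finite_disk_paths finite_fixed_axis)
  also have "\<dots> \<le> card ?E * card ?K"
    using sum_bounded_above[of ?E _ "card ?K"] fiber by simp
  finally show ?thesis .
qed

text \<open>\<open>X\<close> is consulted only at \<open>Disk_Inf\<close>; without one, the lists
  enumerate the choices counted by \<open>completions\<close>.\<close>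

lemma card_disk_paths_no_Inf:
  assumes "\<And>a. finite (X a)" "count_list T Disk_Inf = 0"
  shows "card (disk_paths p X n T u) = completions p (underlying T) u"
  using assms(2)
proof (induction n T arbitrary: u rule: well_formed_items.induct)
  case (2 n s T)
  then show ?case
    by (simp add: card_disk_paths_Slice[of X, OF assms(1)] del: disk_paths.simps)
qed auto

section \<open>The alternating sum of the colors of a level\<close>

definition alternating_sum :: "nat \<Rightarrow> (nat \<Rightarrow> int) \<Rightarrow> int" where
  "alternating_sum n u = (\<Sum>k<n. (- 1) ^ k * u k)"

text \<open>The two equal colors enter with opposite signs, and the strands to their right move by
  two places, which keeps their signs.\<close>

lemma alternating_sum_Birth:
  assumes "i \<le> n"
  shows "alternating_sum (n + 2) (extend (Birth i) c u) = alternating_sum n u"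
  using assms
proof (induction n rule: dec_induct)
  case base
  have "(\<Sum>k<i. (- 1) ^ k * extend (Birth i) c u k) = (\<Sum>k<i. (- 1) ^ k * u k)"
    by (intro sum.cong) auto
  then show ?case by (simp add: alternating_sum_def numeral_2_eq_2)
next
  case (step n)
  then show ?case by (simp add: alternating_sum_def)
qed

text \<open>The last term is the signed contribution of the two joined ends; it vanishes modulo
  \<open>p\<close> exactly when the maximum is passable.\<close>

lemma alternating_sum_Death:
  assumes "i \<le> n"
  shows "alternating_sum n (extend (Death i) c u) =
    alternating_sum (n + 2) u - (- 1) ^ i * (u i - u (Suc i))"
  using assms
proof (induction n rule: dec_induct)
  case base
  have "(\<Sum>k<i. (- 1) ^ k * extend (Death i) c u k) = (\<Sum>k<i. (- 1) ^ k * u k)"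
    by (intro sum.cong) auto
  then show ?case by (simp add: alternating_sum_def numeral_2_eq_2 algebra_simps)
next
  case (step n)
  then show ?case by (simp add: alternating_sum_def)
qed

text \<open>Either kind of crossing changes both colors by the same amount, which cancels between
  neighbours.\<close>

lemma alternating_sum_Cross:
  assumes "i + 2 \<le> n"
  shows "alternating_sum n (extend (Cross b i) c u) = alternating_sum n u"
  using assms
proof (induction n rule: dec_induct)
  case base
  have "(\<Sum>k<i. (- 1) ^ k * extend (Cross b i) c u k) = (\<Sum>k<i. (- 1) ^ k * u k)"
    by (intro sum.cong) auto
  then show ?case by (simp add: alternating_sum_def numeral_2_eq_2 algebra_simps)
next
  case (step n)
  then show ?case by (simp add: alternating_sum_def)
qed

lemma cong_alternating_sum_extend:
  assumes "pos s + ins s \<le> n" "passable p s u"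
  shows "[alternating_sum (width_above n s) (extend s c u) = alternating_sum n u] (mod int p)"
proof (cases s)
  case (Birth i)
  then show ?thesis
    using assms alternating_sum_Birth[of i n c u] by (simp add: width_above_def del: extend.simps)
next
  case (Death i)
  then obtain m where m: "n = m + 2"
    using assms(1) by (metis add.commute le_add2 le_Suc_ex ins.simps(2) le_trans)
  have "int p dvd u i - u (Suc i)"
    using assms(2) Death by (simp add: cong_iff_dvd_diff)
  then show ?thesis
    using assms alternating_sum_Death[of i m c u] Death m
    by (simp add: width_above_def cong_iff_dvd_diff del: extend.simps)
next
  case (Cross b i)
  then have "width_above n s = n"
    using assms(1) by (simp add: width_above_def)
  then show ?thesis
    using assms(1) alternating_sum_Cross[of i n b c u] Cross by simp
qed

text \<open>Every passable slice preserves the sum modulo \<open>p\<close>, and on the empty top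
  line it is 0.\<close>

lemma completions_eq_0:
  assumes "well_formed n D" "\<not> [alternating_sum n u = 0] (mod int p)"
  shows "completions p D u = 0"
  using assms
proof (induction D arbitrary: n u)
  case Nil
  then show ?case by (simp add: alternating_sum_def)
next
  case (Cons s D)
  have "completions p D (extend s c u) = 0" if "passable p s u" for c
    using Cons.prems cong_alternating_sum_extend[OF _ that, of n c]
    by (intro Cons.IH[of "width_above n s"]) (auto intro: cong_trans cong_sym)
  then show ?case by simp
qed

lemma alternating_sum_upd:
  assumes "n > 0"
  shows "alternating_sum n (u(n - 1 := c)) = alternating_sum n u + (- 1) ^ (n - 1) * (c - u (n - 1))"
proof -
  obtain m where m: "n = Suc m" using assms gr0_implies_Suc by blast
  have "(\<Sum>k<m. (- 1) ^ k * (u(m := c)) k) = (\<Sum>k<m. (- 1) ^ k * u k)"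
    by (intro sum.cong) auto
  then show ?thesis by (simp add: m alternating_sum_def algebra_simps)
qed

text \<open>Cutting at the disk gains nothing: the alternating sum is still 0 when the disk is
  reached, and replacing the color \<open>a\<close> by \<open>c\<close> changes it by plus or minus
  \<open>c - a\<close>, so only \<open>c\<close> congruent to \<open>a\<close> can be continued to
  the top.\<close>

lemma card_free_disk_paths:
  assumes "well_formed_items n T" "count_list T Disk_Inf = 1" "p > 0"
    and "[alternating_sum n u = 0] (mod int p)"
  shows "card (disk_paths p (free_axis p) n T u) = completions p (underlying T) u"
  using assms
proof (induction n T arbitrary: u rule: well_formed_items.induct)
  case (2 n s T)
  have "card (disk_paths p (free_axis p) (width_above n s) T (extend s c u)) =
      completions p (underlying T) (extend s c u)" if "passable p s u" for c
    using "2.prems" cong_alternating_sum_extend[OF _ that, of n c]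
    by (intro "2.IH") (auto intro: cong_trans)
  then show ?case by (simp add: card_disk_paths_Slice del: disk_paths.simps)
next
  case (3 n T)
  let ?a = "u (n - 1)" and ?C = "completions p (underlying T)"
  have "card (disk_paths p (free_axis p) n T (u(n - 1 := c))) = ?C (u(n - 1 := c))" for c
    using "3.prems" by (intro card_disk_paths_no_Inf) auto
  then have "card (disk_paths p (free_axis p) n (Disk_Inf # T) u) =
      (\<Sum>c\<in>{0..<int p}. ?C (u(n - 1 := c)))"
    by (simp add: card_disk_paths_Inf del: disk_paths.simps)
  also have "\<dots> = (\<Sum>c\<in>{0..<int p}. if [?a = c] (mod int p) then ?C (u(n - 1 := c)) else 0)"
  proof (rule sum.cong[OF refl])
    fix c
    have "?C (u(n - 1 := c)) = 0" if "\<not> [?a = c] (mod int p)"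
    proof (rule completions_eq_0)
      show "well_formed n (underlying T)"
        using "3.prems"(1) by (simp add: well_formed_underlying)
      have "\<not> int p dvd c - ?a"
        using that by (simp add: cong_iff_dvd_diff dvd_diff_commute)
      then have *: "\<not> int p dvd (- 1) ^ (n - 1) * (c - ?a)"
        by (cases "even (n - 1)") (simp_all add: dvd_diff_commute)
      show "\<not> [alternating_sum n (u(n - 1 := c)) = 0] (mod int p)"
      proof
        assume "[alternating_sum n (u(n - 1 := c)) = 0] (mod int p)"
        then have "int p dvd alternating_sum n u + (- 1) ^ (n - 1) * (c - ?a)"
          using "3.prems"(1) alternating_sum_upd[of n u c] by (simp add: cong_0_iff)
        moreover have "int p dvd alternating_sum n u"
          using "3.prems"(4) by (simp add: cong_0_iff)
        ultimately show False
          using * dvd_add_right_iff by blast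
      qed
    qed
    then show "?C (u(n - 1 := c)) = (if [?a = c] (mod int p) then ?C (u(n - 1 := c)) else 0)"
      by simp
  qed
  also have "\<dots> = ?C (u(n - 1 := ?a mod int p))"
    by (rule sum_single_residue) fact
  also have "\<dots> = ?C u"
    by (rule cong_completions) auto
  finally show ?case by simp
qed auto

text \<open>Every coloring of \<open>D\<close> has exactly one color at the disk, so the classes for
  the various \<open>t\<close> partition the colorings.\<close>

lemma sum_card_fixed_disk_paths:
  assumes "count_list T Disk_Inf = 1" "p > 0"
  shows "(\<Sum>t\<in>{0..<int p}. card (disk_paths p (fixed_axis p t) n T e)) = completions p (underlying T) e"
  using assms(1)
proof (induction n T arbitrary: e rule: well_formed_items.induct)
  case (2 n s T)
  let ?m = "width_above n s"
  have "(\<Sum>t\<in>{0..<int p}. \<Sum>c\<in>new_colors p s. card (disk_paths p (fixed_axis p t) ?m T (extend s c e)))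
      = (\<Sum>c\<in>new_colors p s. \<Sum>t\<in>{0..<int p}. card (disk_paths p (fixed_axis p t) ?m T (extend s c e)))"
    by (rule sum.swap)
  then show ?case
    using 2 by (simp add: card_disk_paths_Slice del: disk_paths.simps)
next
  case (3 n T)
  let ?C = "completions p (underlying T)"
  have "card (disk_paths p (fixed_axis p t) n T u) = ?C u" for t u
    using "3.prems" by (intro card_disk_paths_no_Inf) auto
  then have "card (disk_paths p (fixed_axis p t) n (Disk_Inf # T) e) =
      (if [e (n - 1) = t] (mod int p) then ?C (e(n - 1 := t)) else 0)" for t
    by (simp add: card_disk_paths_Inf fixed_axis_def[of p t "e (n - Suc 0)"] del: disk_paths.simps)
  then have "(\<Sum>t\<in>{0..<int p}. card (disk_paths p (fixed_axis p t) n (Disk_Inf # T) e)) =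
      (\<Sum>t\<in>{0..<int p}. if [e (n - 1) = t] (mod int p) then ?C (e(n - 1 := t)) else 0)"
    by presburger
  also have "\<dots> = ?C (e(n - 1 := e (n - 1) mod int p))"
    by (rule sum_single_residue) fact
  also have "\<dots> = ?C e"
    by (rule cong_completions) auto
  finally show ?case by simp
qed auto

section \<open>Translating colorings\<close>

lemma extend_translate: "extend s (c - t) (\<lambda>k. e k - t) = (\<lambda>k. extend s c e k - t)"
  by (cases s) auto

lemma passable_translate: "passable p s (\<lambda>k. e k - t) \<longleftrightarrow> passable p s e"
  by (cases s) (auto simp: cong_iff_dvd_diff)

text \<open>At a minimum the shift permutes the new colors. Elsewhere the entry 0 is a dummy that a
  shift would move out of \<open>new_colors\<close>; the last assumption says that \<open>f\<close>
  ignores it.\<close>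

lemma sum_translate_new_colors:
  fixes f :: "int \<Rightarrow> nat"
  assumes "p > 0" "\<And>a b. [a = b] (mod int p) \<Longrightarrow> f a = f b"
    and "\<And>a b. new_colors p s = {0} \<Longrightarrow> f a = f b"
  shows "(\<Sum>c\<in>new_colors p s. f (c - t)) = (\<Sum>c\<in>new_colors p s. f c)"
proof (cases s)
  case (Birth i)
  have "f (c - t) = f ((c + (- t)) mod int p)" for c
    by (rule assms(2)) auto
  then show ?thesis
    using sum_shift_mod[OF assms(1), of f "- t"] Birth by simp
qed (use assms(3) in auto)

text \<open>Subtracting \<open>t\<close> from all colors respects the crossing relation, since the
  coefficients in \<open>2 * a - b\<close> add up to 1.\<close>

lemma card_fixed_disk_paths_translate:
  assumes "well_formed_items n T" "p > 0"
  shows "card (disk_paths p (fixed_axis p t) n T e) =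
    card (disk_paths p (fixed_axis p 0) n T (\<lambda>k. e k - t))"
  using assms(1)
proof (induction n T arbitrary: e rule: well_formed_items.induct)
  case (2 n s T)
  let ?f = "\<lambda>c. card (disk_paths p (fixed_axis p 0) (width_above n s) T (extend s c (\<lambda>k. e k - t)))"
  have wf: "well_formed_items (width_above n s) T" using "2.prems" by simp
  have "(\<Sum>c\<in>new_colors p s. card (disk_paths p (fixed_axis p t) (width_above n s) T (extend s c e)))
      = (\<Sum>c\<in>new_colors p s. ?f (c - t))"
    using "2.IH"[OF wf] by (simp add: extend_translate)
  also have "\<dots> = (\<Sum>c\<in>new_colors p s. ?f c)"
  proof (rule sum_translate_new_colors)
    show "?f a = ?f b" if "[a = b] (mod int p)" for a b
      by (intro arg_cong[where f = card] disk_paths_cong wf fixed_axis_cong cong_extend that) auto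
    show "?f a = ?f b" if "new_colors p s = {0}" for a b
    proof (cases s)
      case (Birth i)
      \<comment> \<open>A minimum offers the single color 0 only for \<open>p = 1\<close>, where all
        integers are congruent.\<close>
      then have "int p - 1 \<in> {0::int}"
        using that assms(2) by (metis atLeastLessThan_iff diff_ge_0_iff_ge int_one_le_iff_zero_less
          new_colors.simps(1) of_nat_0_less_iff zle_diff1_eq order_refl)
      then have "int p = 1" by simp
      then show ?thesis
        by (intro arg_cong[where f = card] disk_paths_cong wf fixed_axis_cong cong_extend) auto
    qed simp_all
  qed fact
  finally show ?case
    by (simp add: card_disk_paths_Slice passable_translate del: disk_paths.simps)
next
  case (3 n T)
  have eq: "(\<lambda>k. e k - t)(n - 1 := 0) = (\<lambda>k. (e(n - 1 := t)) k - t)"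
    by auto
  have "card (disk_paths p (fixed_axis p t) n T (e(n - 1 := t))) =
      card (disk_paths p (fixed_axis p 0) n T ((\<lambda>k. e k - t)(n - 1 := 0)))"
    unfolding eq by (rule "3.IH") (use "3.prems" in simp)
  moreover have "[e (n - 1) = t] (mod int p) \<longleftrightarrow> [e (n - 1) - t = 0] (mod int p)"
    by (simp add: cong_iff_dvd_diff)
  ultimately show ?case
    by (simp add: card_disk_paths_Inf del: disk_paths.simps) (simp add: fixed_axis_def)
qed auto

text \<open>By translation the \<open>p\<close> classes are equally large: no strand starts at the
  bottom, so the shift of the starting colors has no effect.\<close>

lemma card_fixed_disk_paths:
  assumes "well_formed_items 0 T" "count_list T Disk_Inf = 1" "p > 0"
  shows "p * card (disk_paths p (fixed_axis p 0) 0 T e) = completions p (underlying T) e"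
proof -
  have "card (disk_paths p (fixed_axis p t) 0 T e) = card (disk_paths p (fixed_axis p 0) 0 T e)" for t
    unfolding card_fixed_disk_paths_translate[OF assms(1,3), of t]
    by (intro arg_cong[where f = card] disk_paths_cong assms(1) fixed_axis_cong) auto
  then have "(\<Sum>t\<in>{0..<int p}. card (disk_paths p (fixed_axis p t) 0 T e)) =
      (\<Sum>t\<in>{0..<int p}. card (disk_paths p (fixed_axis p 0) 0 T e))"
    by (rule sum.cong[OF refl])
  then show ?thesis
    unfolding sum_card_fixed_disk_paths[OF assms(2,3)] by simp
qed

section \<open>The lower bound: mirror-symmetric colorings\<close>

text \<open>With \<open>e\<close> equal to 0 both halves carry the same coloring of
  \<open>D\<close>, and twists do not affect \<open>w\<close>.\<close>

lemma completions_le_card_union_paths: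
  assumes "p > 0"
  shows "completions p (underlying T) w \<le> card (union_paths p n T w (\<lambda>_. 0))"
proof (induction n T arbitrary: w rule: well_formed_items.induct)
  case (2 n s T)
  let ?m = "width_above n s"
  have zero: "extend s 0 (\<lambda>_. 0) = (\<lambda>_. 0)" "passable p s (\<lambda>_. 0)"
    by (cases s; force)+
  have "0 \<in> new_colors p s" using assms by (cases s) auto
  then have "card (union_paths p ?m T (extend s c w) (\<lambda>_. 0)) \<le>
      (\<Sum>d\<in>new_colors p s. card (union_paths p ?m T (extend s c w) (extend s d (\<lambda>_. 0))))" for c
    using member_le_sum[of 0 "new_colors p s"
      "\<lambda>d. card (union_paths p ?m T (extend s c w) (extend s d (\<lambda>_. 0)))"] zero(1) by simp
  then have "(\<Sum>c\<in>new_colors p s. completions p (underlying T) (extend s c w)) \<le>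
      (\<Sum>c\<in>new_colors p s. \<Sum>d\<in>new_colors p s.
         card (union_paths p ?m T (extend s c w) (extend s d (\<lambda>_. 0))))"
    by (intro sum_mono order_trans[OF "2.IH"])
  then show ?case
    using zero(2) by (simp add: card_union_paths_Slice del: union_paths.simps)
next
  case (3 n T)
  \<comment> \<open>Among the colors allowed at the disk, this one continues the strand as if there
    were no disk.\<close>
  let ?a = "w (n - 1) mod int p"
  have "completions p (underlying T) w = completions p (underlying T) (w(n - 1 := ?a))"
    by (rule cong_completions) auto
  also have "\<dots> \<le> card (union_paths p n T (w(n - 1 := ?a)) (\<lambda>_. 0))"
    by (rule "3.IH")
  also have "\<dots> \<le> (\<Sum>c\<in>{0..<int p}. card (union_paths p n T (w(n - 1 := c)) (\<lambda>_. 0)))"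
    using assms by (intro member_le_sum[of ?a _ "\<lambda>c. card (union_paths p n T (w(n - 1 := c)) (\<lambda>_. 0))"]) auto
  finally show ?case
    by (simp add: card_union_paths_Inf fun_upd_idem del: union_paths.simps)
qed auto

section \<open>Counting the colorings of a symmetric union\<close>

text \<open>Here \<open>n\<close> is the width of a half below the slice and \<open>m\<close> that
  of the left half above it, as the slice on the left has already been passed.\<close>

definition mirrored :: "nat \<Rightarrow> nat \<Rightarrow> slice \<Rightarrow> slice" where
  "mirrored m n s = move_to (m + pos (reflect n s)) (reflect n s)"

lemma mirrored_simps:
  "mirrored m n (Birth i) = Birth (m + (n - i))"
  "mirrored m n (Death i) = Death (m + (n - 2 - i))"
  "mirrored m n (Cross b i) = Cross (\<not> b) (m + (n - 2 - i))"
  by (simp_all add: mirrored_def)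

lemma new_colors_mirrored: "new_colors p (mirrored m n s) = new_colors p s"
  by (cases s) (simp_all add: mirrored_simps)

lemma extend_mirrored_left: "k < m \<Longrightarrow> extend (mirrored m n s) c v k = v k"
  by (cases s) (simp_all add: mirrored_simps)

text \<open>Strand \<open>k\<close> reappears \<open>k\<close> places from the right end, whence
  \<open>n - 1 - k\<close>; the feet of a maximum are exchanged.\<close>

lemma passable_mirrored:
  assumes "pos s + ins s \<le> n"
    and "\<And>k. k < n \<Longrightarrow> [v (m + (n - 1 - k)) = w k] (mod int p)"
  shows "passable p (mirrored m n s) v \<longleftrightarrow> passable p s w"
proof (cases s)
  case (Death i)
  then have "n - 1 - i = Suc (n - 2 - i)" "n - 1 - Suc i = n - 2 - i" "i < n" "Suc i < n"
    using assms(1) by auto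
  then have "[v (m + (n - 2 - i)) = w (Suc i)] (mod int p)" "[v (Suc (m + (n - 2 - i))) = w i] (mod int p)"
    using assms(2)[of i] assms(2)[of "Suc i"] by simp_all
  then show ?thesis
    unfolding Death mirrored_simps passable.simps by (meson cong_sym cong_trans)
qed (simp_all add: mirrored_simps)

text \<open>Reflection exchanges the ends of a crossing and flips its flag, so the overstrand stays
  over and the same color rule results.\<close>

lemma extend_mirrored_right:
  assumes "pos s + ins s \<le> n"
    and v: "\<And>k. k < n \<Longrightarrow> [v (m + (n - 1 - k)) = w k] (mod int p)"
    and k: "k < width_above n s"
  shows "[extend (mirrored m n s) c v (m + (width_above n s - 1 - k)) = extend s c w k] (mod int p)"
proof (cases s)
  case (Birth i)
  have wa: "width_above n s = n + 2" using Birth by (simp add: width_above_def)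
  have i: "i \<le> n" using assms(1) Birth by simp
  consider "k < i" | "k = i" | "k = Suc i" | "i + 2 \<le> k" by linarith
  then show ?thesis
  proof cases
    case 1
    then have "m + (n + 2 - 1 - k) - 2 = m + (n - 1 - k)" "\<not> m + (n + 2 - 1 - k) < m + (n - i) + 2"
      using i by linarith+
    then show ?thesis
      using v[of k] 1 i unfolding wa unfolding Birth mirrored_simps by simp
  next
    case 4
    then have "m + (n + 2 - 1 - k) = m + (n - 1 - (k - 2))" "m + (n + 2 - 1 - k) < m + (n - i)" "k - 2 < n"
      using k wa by linarith+
    then show ?thesis
      using v[of "k - 2"] 4 unfolding wa unfolding Birth mirrored_simps by simp
  qed (use i in \<open>unfold wa, unfold Birth mirrored_simps, auto\<close>)
next
  case (Death i)
  have wa: "width_above n s = n - 2" using Death by (simp add: width_above_def)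
  have i: "i + 2 \<le> n" using assms(1) Death by simp
  show ?thesis
  proof (cases "k < i")
    case True
    then have "m + (n - 2 - 1 - k) + 2 = m + (n - 1 - k)" "\<not> m + (n - 2 - 1 - k) < m + (n - 2 - i)"
      using i by linarith+
    then show ?thesis
      using v[of k] True i unfolding wa unfolding Death mirrored_simps by simp
  next
    case False
    then have "n - 2 - 1 - k = n - 1 - (k + 2)" "m + (n - 2 - 1 - k) < m + (n - 2 - i)" "k + 2 < n"
      using k wa by linarith+
    then show ?thesis
      using v[of "k + 2"] False unfolding wa unfolding Death mirrored_simps by simp
  qed
next
  case (Cross b i)
  have i: "i + 2 \<le> n" using assms(1) Cross by simp
  have wa: "width_above n s = n" using Cross i by (simp add: width_above_def)
  have idx: "n - 1 - i = Suc (n - 2 - i)" "n - 1 - Suc i = n - 2 - i"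
    using i by linarith+
  have v_i: "[v (Suc (m + (n - 2 - i))) = w i] (mod int p)"
    "[v (m + (n - 2 - i)) = w (Suc i)] (mod int p)"
    using v[of i] v[of "Suc i"] i unfolding idx by simp_all
  consider "k = i" | "k = Suc i" | "k \<noteq> i" "k \<noteq> Suc i" by blast
  then show ?thesis
  proof cases
    case 1
    then show ?thesis
      using v_i unfolding wa unfolding Cross mirrored_simps 1 idx
      by (auto intro!: cong_diff cong_mult)
  next
    case 2
    then show ?thesis
      using v_i unfolding wa unfolding Cross mirrored_simps 2 idx
      by (auto intro!: cong_diff cong_mult)
  next
    case 3
    then have "m + (n - 1 - k) \<noteq> m + (n - 2 - i)" "m + (n - 1 - k) \<noteq> Suc (m + (n - 2 - i))" "k < n"
      using k wa i by linarith+
    then show ?thesis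
      using v[of k] 3 unfolding wa unfolding Cross mirrored_simps by simp
  qed
qed

text \<open>Describes the right half while a slice acts on the left: its strands shift with the
  width and keep their colors.\<close>

lemma extend_above:
  assumes "pos s + ins s \<le> n"
  shows "extend s c v (width_above n s + k) = v (n + k)"
proof -
  obtain m where "n = pos s + ins s + m"
    using assms le_Suc_ex by blast
  then show ?thesis
    by (cases s) (simp_all add: width_above_def)
qed

lemma extend_add: "extend s (c + d) (\<lambda>k. u k + v k) k = extend s c u k + extend s d v k"
  by (cases s) (auto simp: algebra_simps)

text \<open>A change of variables from the colors \<open>x\<close> on the left and \<open>c\<close>
  on the right to \<open>c\<close> and their difference.\<close>

lemma sum_new_colors_difference:
  fixes f :: "int \<Rightarrow> int \<Rightarrow> nat"
  assumes "p > 0"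
  shows "(\<Sum>x\<in>new_colors p s. \<Sum>c\<in>new_colors p s. f c ((x - c) mod int p)) =
    (\<Sum>c\<in>new_colors p s. \<Sum>d\<in>new_colors p s. f c d)"
proof (cases s)
  case (Birth i)
  have "(\<Sum>x\<in>{0..<int p}. f c ((x - c) mod int p)) = (\<Sum>d\<in>{0..<int p}. f c d)" for c
    using sum_shift_mod[OF assms, of "f c" "- c"] by simp
  then show ?thesis
    unfolding Birth new_colors.simps by (subst sum.swap) simp
qed simp_all

section \<open>Twist regions and the full count\<close>

lemma extend_Cross_axis:
  "extend (Cross b i) c v k =
     (if k = i \<or> k = Suc i then v k + (if b then 1 else - 1) * (v i - v (Suc i)) else v k)"
  by auto

text \<open>Each crossing adds one signed difference to both colors and so preserves that
  difference; hence \<open>q\<close> crossings add the same amount \<open>q\<close> times.\<close>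

lemma completions_twist:
  "completions p (replicate q (Cross b i) @ D) v = completions p D (\<lambda>k.
     if k = i \<or> k = Suc i then v k + (if b then 1 else - 1) * int q * (v i - v (Suc i)) else v k)"
proof (induction q arbitrary: v)
  case 0
  have "(\<lambda>k. if k = i \<or> k = Suc i then v k + (if b then 1 else - 1) * int 0 * (v i - v (Suc i)) else v k) = v"
    by auto
  then show ?case by simp
next
  case (Suc q)
  let ?v = "extend (Cross b i) 0 v"
  have "completions p (replicate (Suc q) (Cross b i) @ D) v =
      completions p (replicate q (Cross b i) @ D) ?v"
    by (simp del: extend.simps)
  also have "\<dots> = completions p D (\<lambda>k. if k = i \<or> k = Suc i
      then ?v k + (if b then 1 else - 1) * int q * (?v i - ?v (Suc i)) else ?v k)"
    by (rule Suc.IH)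
  also have "(\<lambda>k. if k = i \<or> k = Suc i
      then ?v k + (if b then 1 else - 1) * int q * (?v i - ?v (Suc i)) else ?v k) =
      (\<lambda>k. if k = i \<or> k = Suc i
      then v k + (if b then 1 else - 1) * int (Suc q) * (v i - v (Suc i)) else v k)"
    unfolding extend_Cross_axis by (auto simp: algebra_simps)
  finally show ?case .
qed

text \<open>Position \<open>k\<close> on the left carries \<open>w k + e k\<close> and its mirror
  position \<open>n + (n - 1 - k)\<close> carries \<open>w k\<close>. Slices off the axis act
  linearly and alike on both halves, so they act separately on \<open>w\<close> and
  \<open>e\<close>.\<close>

lemma completions_symmetric_union:
  assumes "well_formed_items n T" "p > 0"
    and "\<And>k. k < n \<Longrightarrow> [v k = w k + e k] (mod int p)"
    and "\<And>k. k < n \<Longrightarrow> [v (n + (n - 1 - k)) = w k] (mod int p)"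
  shows "completions p (symmetric_union n T) v = card (union_paths p n T w e)"
  using assms(1,3,4)
proof (induction n T arbitrary: v w e rule: well_formed_items.induct)
  case (2 n s T)
  let ?m = "width_above n s"
  let ?s = "mirrored ?m n s"
  let ?N = "new_colors p s"
  have s: "pos s + ins s \<le> n" and wf: "well_formed_items ?m T"
    using "2.prems"(1) by auto
  have right: "[extend s x v (?m + (n - 1 - k)) = w k] (mod int p)" if "k < n" for x k
    using "2.prems"(3)[OF that] extend_above[OF s] by simp
  have v: "passable p s v \<longleftrightarrow> passable p s (\<lambda>k. w k + e k)"
    by (rule cong_passable_below[OF s]) (rule "2.prems"(2))
  have e: "passable p s e" if "passable p s (\<lambda>k. w k + e k)" "passable p s w"
    using passable_diff[OF that] by simp
  \<comment> \<open>Here \<open>x\<close> is the new color on the left and \<open>c\<close> the one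
    on the right, so \<open>e\<close> receives the representative of \<open>x - c\<close>.\<close>
  have IH: "completions p (symmetric_union ?m T) (extend ?s c (extend s x v)) =
      card (union_paths p ?m T (extend s c w) (extend s ((x - c) mod int p) e))" for x c
  proof (rule "2.IH"[OF wf])
    fix k assume k: "k < ?m"
    have "extend ?s c (extend s x v) k = extend s x v k"
      by (rule extend_mirrored_left[OF k])
    also have "[\<dots> = extend s (c + (x - c) mod int p) (\<lambda>k. w k + e k) k] (mod int p)"
      by (rule cong_extend_below[OF s _ _ k]) (use "2.prems"(2) in \<open>auto simp: cong_def mod_simps\<close>)
    also have "extend s (c + (x - c) mod int p) (\<lambda>k. w k + e k) k =
        extend s c w k + extend s ((x - c) mod int p) e k"
      by (rule extend_add)
    finally show "[extend ?s c (extend s x v) k =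
        extend s c w k + extend s ((x - c) mod int p) e k] (mod int p)" .
    show "[extend ?s c (extend s x v) (?m + (?m - 1 - k)) = extend s c w k] (mod int p)"
      by (rule extend_mirrored_right[OF s _ k]) (rule right)
  qed
  have unfold: "symmetric_union n (Slice s # T) = s # ?s # symmetric_union ?m T"
    by (simp add: Let_def mirrored_def)
  have "passable p ?s (extend s x v) \<longleftrightarrow> passable p s w" for x
    by (rule passable_mirrored[OF s]) (rule right)
  then have "completions p (symmetric_union n (Slice s # T)) v =
      (if passable p s v \<and> passable p s w then \<Sum>x\<in>?N. \<Sum>c\<in>?N.
         card (union_paths p ?m T (extend s c w) (extend s ((x - c) mod int p) e)) else 0)"
    unfolding unfold by (simp add: IH new_colors_mirrored)
  also have "\<dots> = (if passable p s v \<and> passable p s w then \<Sum>c\<in>?N. \<Sum>d\<in>?N.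
         card (union_paths p ?m T (extend s c w) (extend s d e)) else 0)"
    using sum_new_colors_difference[OF assms(2), of "\<lambda>c d. card (union_paths p ?m T (extend s c w) (extend s d e))" s]
    by simp
  also have "\<dots> = card (union_paths p n (Slice s # T) w e)"
    unfolding card_union_paths_Slice using v e passable_add[of p s w e] by auto
  finally show ?case .
next
  case (3 n T)
  obtain m where n: "n = Suc m" and wf: "well_formed_items n T"
    using "3.prems"(1) gr0_implies_Suc by auto
  let ?v = "\<lambda>c. extend (Birth m) c (extend (Death m) 0 v)"
  \<comment> \<open>Past the disk both strands next to the axis carry the fresh color
    \<open>c\<close>: at \<open>m\<close>, \<open>w\<close> becomes \<open>c\<close> and
    \<open>e\<close> becomes 0.\<close>
  have v: "?v c k = (if k = m \<or> k = Suc m then c else v k)" for c k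
  proof (cases "k < m + 2")
    case False
    then have "Suc (Suc (k - 2)) = k" by linarith
    then show ?thesis using False by simp
  qed auto
  have IH: "completions p (symmetric_union n T) (?v c) =
      card (union_paths p n T (w(m := c)) (e(m := 0)))" for c
    using "3.prems"(2,3) n unfolding v
    by (intro "3.IH" wf) (auto simp: n)
  \<comment> \<open>The maximum on the axis joins these two strands, which forces \<open>e m\<close>
    to vanish modulo \<open>p\<close>.\<close>
  have "[v m = w m + e m] (mod int p)" "[v (Suc m) = w m] (mod int p)"
    using "3.prems"(2)[of m] "3.prems"(3)[of m] n by simp_all
  then have "[v m = v (Suc m)] (mod int p) \<longleftrightarrow> [w m + e m = w m] (mod int p)"
    by (meson cong_sym cong_trans)
  also have "\<dots> \<longleftrightarrow> [e m = 0] (mod int p)"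
    by (simp add: cong_iff_dvd_diff)
  finally show ?case
    using IH by (simp add: card_union_paths_Inf n del: union_paths.simps extend.simps)
next
  case (4 n k T)
  obtain m where n: "n = Suc m" and wf: "well_formed_items n T"
    using "4.prems"(1) gr0_implies_Suc by auto
  have sgn: "(if k > 0 then 1 else - 1) * int (nat \<bar>k\<bar>) = k"
    by simp
  have vm: "[v m = w m + e m] (mod int p)" "[v (Suc m) = w m] (mod int p)"
    using "4.prems"(2)[of m] "4.prems"(3)[of m] n by simp_all
  then have d: "[k * (v m - v (Suc m)) = k * e m] (mod int p)"
    using cong_diff[OF vm] by (intro cong_mult) auto
  \<comment> \<open>Both axis strands gain \<open>k\<close> times their difference, that is
    \<open>k * e m\<close> modulo \<open>p\<close>; so \<open>w m\<close> is shifted while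
    \<open>e m\<close> stays.\<close>
  let ?v = "\<lambda>i. if i = m \<or> i = Suc m then v i + k * (v m - v (Suc m)) else v i"
  have "completions p (symmetric_union n (Disk_Twist k # T)) v = completions p (symmetric_union n T) ?v"
    using completions_twist[of p "nat \<bar>k\<bar>" "k > 0" m "symmetric_union n T" v] unfolding sgn
    by (simp add: n)
  also have "\<dots> = card (union_paths p n T (w(m := w m + k * e m)) e)"
  proof (rule "4.IH"[OF wf])
    fix i assume i: "i < n"
    show "[?v i = (w(m := w m + k * e m)) i + e i] (mod int p)"
      using "4.prems"(2)[OF i] cong_add[OF vm(1) d] i n by (auto simp: algebra_simps)
    show "[?v (n + (n - 1 - i)) = (w(m := w m + k * e m)) i] (mod int p)"
      using "4.prems"(3)[OF i] cong_add[OF vm(2) d] i n by auto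
  qed
  finally show ?case by (simp add: n)
qed simp

theorem theorem1p3:
  fixes p :: nat and K J :: "slice list set"
  assumes "prime p"
    and "K \<in> knots" and "J \<in> knots"
    and "has_symmetric_union_presentation K J"
  shows "col p J \<le> col p K \<and> real (col p K) \<le> (real (col p J))\<^sup>2 / real p"
proof -
  have p: "p > 0" using assms(1) prime_gt_0_nat by blast
  obtain T where T: "diagram_with_disks T" "underlying T \<in> J" "symmetric_union 0 T \<in> K"
    using assms(4) by (auto simp: has_symmetric_union_presentation_def)
  have Inf: "count_list T Disk_Inf = 1"
    using T(1) by (simp add: diagram_with_disks_def)
  have wf: "well_formed_items 0 T"
    using T(1) by (intro well_formed_itemsI)
      (auto simp: diagram_with_disks_def knot_diagram_def diagram_iff_well_formed)
  let ?zero = "\<lambda>_::nat. 0::int"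
  let ?E = "card (disk_paths p (fixed_axis p 0) 0 T ?zero)"
  have J: "col p J = completions p (underlying T) ?zero"
    by (rule col_eq_completions[OF assms(3) T(2) p])
  have "col p K = completions p (symmetric_union 0 T) ?zero"
    by (rule col_eq_completions[OF assms(2) T(3) p])
  also have "\<dots> = card (union_paths p 0 T ?zero ?zero)"
    by (rule completions_symmetric_union[OF wf p]) auto
  finally have K: "col p K = card (union_paths p 0 T ?zero ?zero)" .
  \<comment> \<open>The alternating sum at the bottom is the empty sum, so the cut diagram has just
    \<open>col p J\<close> colorings.\<close>
  have kernel: "card (disk_paths p (free_axis p) 0 T ?zero) = col p J"
    unfolding J by (rule card_free_disk_paths[OF wf Inf p]) (simp add: alternating_sum_def)
  have "p * ?E = col p J"
    unfolding J by (rule card_fixed_disk_paths[OF wf Inf p])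
  then have E: "real ?E = real (col p J) / real p"
    using p by (metis nonzero_mult_div_cancel_left of_nat_0_less_iff of_nat_mult order_less_irrefl)
  \<comment> \<open>The first factor counts the possible differences \<open>e\<close>, the second
    bounds the colorings that share one.\<close>
  have "col p K \<le> ?E * col p J"
    using card_union_paths_le[OF wf p, of ?zero ?zero] unfolding K kernel .
  then have "real (col p K) \<le> real ?E * real (col p J)"
    by (metis of_nat_le_iff of_nat_mult)
  then have "real (col p K) \<le> (real (col p J))\<^sup>2 / real p"
    by (simp add: E power2_eq_square)
  moreover have "col p J \<le> col p K"
    unfolding J K by (rule completions_le_card_union_paths[OF p])
  ultimately show ?thesis by blast
qed

end
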